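(* Let $\mathcal{M}$ be an ultrahomogeneous $\mathcal{L}$-structure. Then the following are equivalent: (1) $\mathrm{Aut}(\mathcal{M})$ is extremely amenable. (2) $\mathrm{Age}(\mathcal{M})$ is a finitary Ramsey class.
   Context: $\mathcal{L}$ is a first-order language; structures need not be countable, relational or locally finite. $\mathcal{M}$ is ultrahomogeneous if every isomorphism between finitely generated substructures extends to an automorphism of $\mathcal{M}$. $\mathrm{Aut}(\mathcal{M})$ carries the topology of pointwise convergence ($M$ discrete); a topological group is extremely amenable if every continuous action of it on a nonempty compact Hausdorff space has a fixed point. $\mathrm{Age}(\mathcal{M})$ is the class of (isomorphism types of) finitely generated substructures of $\mathcal{M}$, treated as an isomorphism-closed class. For structures $M,N$, a finite subset $A\subseteq M$ and a subset $C\subseteq N$, $\binom{C}{A}$ denotes the set of copies of $A$ in $C$ with the same quantifier-free type, i.e. the set of maps $f:A\to C$ with $\mathrm{qftp}_N(f(\bar a))=\mathrm{qftp}_M(\bar a)$ for an enumeration $\bar a$ of $A$ (quantifier-free types are complete, over $\emptyset$, and computed in the ambient structure). Write $C\to(B)^A_2$ if for every $\chi:\binom{C}{A}\to\{0,1\}$ there is $e\in\binom{C}{B}$ such that $\chi$ is constant on the set of those $f\in\binom{C}{A}$ with image contained in $e(B)$. A class $\mathcal{C}$ of structures has the finitary embedding Ramsey property (f-ERP) if for every $M\in\mathcal{C}$ and all finite subsets $A,B\subseteq M$ there are $N\in\mathcal{C}$ and a finite subset $C\subseteq N$ with $C\to(B)^A_2$. It is a finitary Ramsey class if it has HP (closed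 under finitely generated substructures), JEP (any two members embed in a common member) and f-ERP. *)

theory Defs
  imports "HOL-Analysis.Analysis" "HOL-Algebra.Group_Action"
begin

text \<open>The symbols form subsets of the types \<open>'f\<close> and \<open>'r\<close>, so that a language may lack function
  symbols or relation symbols altogether. Constants are function symbols of arity \<open>0\<close>.\<close>

record ('f, 'r) language =
  fsyms :: "'f set"
  rsyms :: "'r set"
  farity :: "'f \<Rightarrow> nat"
  rarity :: "'r \<Rightarrow> nat"

text \<open>The interpretations are only meaningful for symbols of the language and for argument lists of
  the right length with entries in the universe; all notions below ignore the other values. The
  universe is allowed to be empty (if there are no constants).\<close>

record ('f, 'r, 'm) struct =
  univ :: "'m set"
  fint :: "'f \<Rightarrow> 'm list \<Rightarrow> 'm"
  rint :: "'r \<Rightarrow> 'm list \<Rightarrow> bool"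

definition is_structure :: "('f, 'r) language \<Rightarrow> ('f, 'r, 'm) struct \<Rightarrow> bool" where
  "is_structure L M \<longleftrightarrow>
     (\<forall>f\<in>fsyms L. \<forall>xs. length xs = farity L f \<and> set xs \<subseteq> univ M \<longrightarrow> fint M f xs \<in> univ M)"

definition embedding ::
    "('f, 'r) language \<Rightarrow> ('f, 'r, 'm) struct \<Rightarrow> ('f, 'r, 'n) struct \<Rightarrow> ('m \<Rightarrow> 'n) \<Rightarrow> bool" where
  "embedding L M N h \<longleftrightarrow>
     is_structure L M \<and> is_structure L N \<and> h \<in> univ M \<rightarrow> univ N \<and> inj_on h (univ M) \<and>
     (\<forall>f\<in>fsyms L. \<forall>xs. length xs = farity L f \<and> set xs \<subseteq> univ M \<longrightarrow>
        h (fint M f xs) = fint N f (map h xs)) \<and>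
     (\<forall>r\<in>rsyms L. \<forall>xs. length xs = rarity L r \<and> set xs \<subseteq> univ M \<longrightarrow>
        (rint M r xs \<longleftrightarrow> rint N r (map h xs)))"

definition isomorphism ::
    "('f, 'r) language \<Rightarrow> ('f, 'r, 'm) struct \<Rightarrow> ('f, 'r, 'n) struct \<Rightarrow> ('m \<Rightarrow> 'n) \<Rightarrow> bool" where
  "isomorphism L M N h \<longleftrightarrow> embedding L M N h \<and> h ` univ M = univ N"

definition substructure ::
    "('f, 'r) language \<Rightarrow> ('f, 'r, 'm) struct \<Rightarrow> ('f, 'r, 'm) struct \<Rightarrow> bool" where
  "substructure L N M \<longleftrightarrow> univ N \<subseteq> univ M \<and> embedding L N M (\<lambda>x. x)"

inductive_set generated ::
    "('f, 'r) language \<Rightarrow> ('f, 'r, 'm) struct \<Rightarrow> 'm set \<Rightarrow> 'm set"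
  for L :: "('f, 'r) language" and M :: "('f, 'r, 'm) struct" and A :: "'m set" where
  base: "x \<in> A \<Longrightarrow> x \<in> generated L M A"
| app: "\<lbrakk>f \<in> fsyms L; length xs = farity L f; \<forall>x\<in>set xs. x \<in> generated L M A\<rbrakk>
        \<Longrightarrow> fint M f xs \<in> generated L M A"

definition finitely_generated :: "('f, 'r) language \<Rightarrow> ('f, 'r, 'm) struct \<Rightarrow> bool" where
  "finitely_generated L M \<longleftrightarrow> (\<exists>A. finite A \<and> A \<subseteq> univ M \<and> generated L M A = univ M)"

text \<open>Isomorphism-closed among the structures whose elements have type \<open>'m\<close>; every finitely
  generated substructure of \<open>M\<close>, and hence every isomorphism type in the age, occurs here.\<close>

definition Age :: "('f, 'r) language \<Rightarrow> ('f, 'r, 'm) struct \<Rightarrow> ('f, 'r, 'm) struct set" where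
  "Age L M = {N. \<exists>S h. substructure L S M \<and> finitely_generated L S \<and> isomorphism L S N h}"

text \<open>As in \<^const>\<open>BijGroup\<close>, automorphisms are extensional functions on the universe.\<close>

definition Aut :: "('f, 'r) language \<Rightarrow> ('f, 'r, 'm) struct \<Rightarrow> ('m \<Rightarrow> 'm) monoid" where
  "Aut L M = (BijGroup (univ M))\<lparr>carrier := {g \<in> Bij (univ M). isomorphism L M M g}\<rparr>"

definition pointwise_topology ::
    "('f, 'r) language \<Rightarrow> ('f, 'r, 'm) struct \<Rightarrow> ('m \<Rightarrow> 'm) topology" where
  "pointwise_topology L M =
     subtopology (product_topology (\<lambda>_. discrete_topology (univ M)) (univ M)) (carrier (Aut L M))"

definition ultrahomogeneous :: "('f, 'r) language \<Rightarrow> ('f, 'r, 'm) struct \<Rightarrow> bool" where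
  "ultrahomogeneous L M \<longleftrightarrow>
     (\<forall>N N' h. substructure L N M \<and> finitely_generated L N \<and>
        substructure L N' M \<and> finitely_generated L N' \<and> isomorphism L N N' h \<longrightarrow>
        (\<exists>g\<in>carrier (Aut L M). \<forall>x\<in>univ N. g x = h x))"

definition continuous_action ::
    "('g, 'b) monoid_scheme \<Rightarrow> 'g topology \<Rightarrow> 'x topology \<Rightarrow> ('g \<Rightarrow> 'x \<Rightarrow> 'x) \<Rightarrow> bool" where
  "continuous_action G T X \<phi> \<longleftrightarrow>
     group_action G (topspace X) \<phi> \<and> continuous_map (prod_topology T X) X (\<lambda>(g, x). \<phi> g x)"

text \<open>A formula cannot quantify over types, so the type \<open>'x\<close> carrying the compact spaces is a
  parameter. Every compact Hausdorff \<open>G\<close>-space contains the closure of an orbit, a compact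
  invariant subspace with a dense subset \<open>D\<close> that is an image of \<open>G\<close>; as
  \<open>x \<mapsto> {A. A \<subseteq> D \<and> x \<in> closure A}\<close> is injective on this closure, the instance
  \<open>'x = 'g set set\<close> already yields fixed points for the compact Hausdorff \<open>G\<close>-spaces on all types.\<close>

definition extremely_amenable ::
    "'x itself \<Rightarrow> ('g, 'b) monoid_scheme \<Rightarrow> 'g topology \<Rightarrow> bool" where
  "extremely_amenable _ G T \<longleftrightarrow>
     (\<forall>(X :: 'x topology) \<phi>. topspace X \<noteq> {} \<and> compact_space X \<and> Hausdorff_space X \<and>
        continuous_action G T X \<phi> \<longrightarrow> (\<exists>x\<in>topspace X. \<forall>g\<in>carrier G. \<phi> g x = x))"

datatype 'f trm = Var nat | Fun 'f "'f trm list"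

datatype ('f, 'r) qff =
    Falsity
  | Eql "'f trm" "'f trm"
  | Rel 'r "'f trm list"
  | Neg "('f, 'r) qff"
  | Conj "('f, 'r) qff" "('f, 'r) qff"

primrec wf_trm :: "('f, 'r) language \<Rightarrow> nat \<Rightarrow> 'f trm \<Rightarrow> bool" where
  "wf_trm L n (Var i) \<longleftrightarrow> i < n"
| "wf_trm L n (Fun f ts) \<longleftrightarrow> f \<in> fsyms L \<and> length ts = farity L f \<and> list_all (wf_trm L n) ts"

primrec wf_qff :: "('f, 'r) language \<Rightarrow> nat \<Rightarrow> ('f, 'r) qff \<Rightarrow> bool" where
  "wf_qff L n Falsity \<longleftrightarrow> True"
| "wf_qff L n (Eql s t) \<longleftrightarrow> wf_trm L n s \<and> wf_trm L n t"
| "wf_qff L n (Rel r ts) \<longleftrightarrow> r \<in> rsyms L \<and> length ts = rarity L r \<and> list_all (wf_trm L n) ts"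
| "wf_qff L n (Neg p) \<longleftrightarrow> wf_qff L n p"
| "wf_qff L n (Conj p q) \<longleftrightarrow> wf_qff L n p \<and> wf_qff L n q"

primrec trm_val :: "('f, 'r, 'm) struct \<Rightarrow> 'm list \<Rightarrow> 'f trm \<Rightarrow> 'm" where
  "trm_val M as (Var i) = as ! i"
| "trm_val M as (Fun f ts) = fint M f (map (trm_val M as) ts)"

primrec sat :: "('f, 'r, 'm) struct \<Rightarrow> 'm list \<Rightarrow> ('f, 'r) qff \<Rightarrow> bool" where
  "sat M as Falsity \<longleftrightarrow> False"
| "sat M as (Eql s t) \<longleftrightarrow> trm_val M as s = trm_val M as t"
| "sat M as (Rel r ts) \<longleftrightarrow> rint M r (map (trm_val M as) ts)"
| "sat M as (Neg p) \<longleftrightarrow> \<not> sat M as p"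
| "sat M as (Conj p q) \<longleftrightarrow> sat M as p \<and> sat M as q"

definition qftp ::
    "('f, 'r) language \<Rightarrow> ('f, 'r, 'm) struct \<Rightarrow> 'm list \<Rightarrow> ('f, 'r) qff set" where
  "qftp L M as = {p. wf_qff L (length as) p \<and> sat M as p}"

text \<open>\<open>copies L M A N C\<close> renders $\binom{C}{A}$ for a finite \<open>A \<subseteq> univ M\<close> and \<open>C \<subseteq> univ N\<close>.
  The copies are extensional functions, so that distinct copies differ on \<open>A\<close>.\<close>

definition copies ::
    "('f, 'r) language \<Rightarrow> ('f, 'r, 'm) struct \<Rightarrow> 'm set \<Rightarrow> ('f, 'r, 'n) struct \<Rightarrow> 'n set \<Rightarrow>
     ('m \<Rightarrow> 'n) set" where
  "copies L M A N C =
     {f \<in> A \<rightarrow>\<^sub>E C. \<exists>as. distinct as \<and> set as = A \<and> qftp L N (map f as) = qftp L M as}"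

text \<open>\<open>ramsey_arrow L M A B N C\<close> renders $C \to (B)^A_2$ for \<open>A, B \<subseteq> univ M\<close> and \<open>C \<subseteq> univ N\<close>.\<close>

definition ramsey_arrow ::
    "('f, 'r) language \<Rightarrow> ('f, 'r, 'm) struct \<Rightarrow> 'm set \<Rightarrow> 'm set \<Rightarrow>
     ('f, 'r, 'n) struct \<Rightarrow> 'n set \<Rightarrow> bool" where
  "ramsey_arrow L M A B N C \<longleftrightarrow>
     (\<forall>k \<in> (copies L M A N C \<rightarrow> {0, 1 :: nat}). \<exists>e \<in> copies L M B N C. \<exists>c.
        \<forall>f \<in> copies L M A N C. f ` A \<subseteq> e ` B \<longrightarrow> k f = c)"

definition f_ERP :: "('f, 'r) language \<Rightarrow> ('f, 'r, 'm) struct set \<Rightarrow> bool" where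
  "f_ERP L K \<longleftrightarrow>
     (\<forall>M\<in>K. \<forall>A B. finite A \<and> A \<subseteq> univ M \<and> finite B \<and> B \<subseteq> univ M \<longrightarrow>
        (\<exists>N\<in>K. \<exists>C. finite C \<and> C \<subseteq> univ N \<and> ramsey_arrow L M A B N C))"

definition HP :: "('f, 'r) language \<Rightarrow> ('f, 'r, 'm) struct set \<Rightarrow> bool" where
  "HP L K \<longleftrightarrow> (\<forall>M\<in>K. \<forall>N. substructure L N M \<and> finitely_generated L N \<longrightarrow> N \<in> K)"

definition JEP :: "('f, 'r) language \<Rightarrow> ('f, 'r, 'm) struct set \<Rightarrow> bool" where
  "JEP L K \<longleftrightarrow>
     (\<forall>M\<in>K. \<forall>M'\<in>K. \<exists>N\<in>K. (\<exists>h. embedding L M N h) \<and> (\<exists>h'. embedding L M' N h'))"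

definition finitary_Ramsey_class :: "('f, 'r) language \<Rightarrow> ('f, 'r, 'm) struct set \<Rightarrow> bool" where
  "finitary_Ramsey_class L K \<longleftrightarrow> HP L K \<and> JEP L K \<and> f_ERP L K"

end

theory Submission imports Defs begin

text \<open>HP and JEP always hold for the age, so the point is to compare extreme amenability with f-ERP.
  By ultrahomogeneity, the copies of a finite set in \<open>M\<close> are the restrictions of automorphisms, so f-ERP
  of the age says: for finite \<open>A, B\<close> there is a finite \<open>C\<close> such that every 2-colouring of the
  restrictions to \<open>A\<close> with values in \<open>C\<close> is constant on those with values in some \<open>g B \<subseteq> C\<close>, and
  this can be iterated to obtain any finite number of colours.

  If a compact action had no fixed point, finitely many open sets \<open>U j\<close>, each moved off itself by some
  \<open>g j\<close>, would cover the space robustly: for some finite \<open>A\<close>, every orbit under the stabiliser of \<open>A\<close> is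
  contained in some \<open>U j\<close>. Colouring the coset of \<open>h\<close> by a \<open>j\<close> with \<open>h\<inverse> x \<in> U j\<close> and applying the Ramsey
  property to \<open>B = A \<union> (\<Union>j. (g j)\<inverse> A)\<close> puts both \<open>h\<inverse> x\<close> and \<open>g j (h\<inverse> x)\<close> into the same \<open>U j\<close>.

  Conversely, if no \<open>C\<close> works for \<open>A, B\<close>, then by compactness the colourings of all restrictions to \<open>A\<close>
  that are non-constant below every \<open>g B\<close> form a nonempty closed invariant set; a fixed point in it is a
  constant colouring, as the group is transitive on the restrictions.\<close>

section \<open>Embeddings, generated substructures and the age\<close>

lemma embedding_structure:
  assumes "embedding L M N h"
  shows "is_structure L M" "is_structure L N"
  using assms by (auto simp: embedding_def)

lemma embedding_comp:
  assumes "embedding L M N h" "embedding L N K k"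
  shows "embedding L M K (k \<circ> h)"
proof -
  have sub: "set (map h xs) \<subseteq> univ N" if "set xs \<subseteq> univ M" for xs
    using assms(1) that by (auto simp: embedding_def)
  have fn: "k (h (fint M f xs)) = fint K f (map (k \<circ> h) xs)"
    if "f \<in> fsyms L" "length xs = farity L f" "set xs \<subseteq> univ M" for f xs
  proof -
    have "h (fint M f xs) = fint N f (map h xs)"
      using assms(1) that by (auto simp: embedding_def)
    moreover have "k (fint N f (map h xs)) = fint K f (map k (map h xs))"
      using assms(2) that sub[OF that(3)] unfolding embedding_def by (metis length_map)
    ultimately show ?thesis by simp
  qed
  have rl: "rint M r xs \<longleftrightarrow> rint K r (map (k \<circ> h) xs)"
    if "r \<in> rsyms L" "length xs = rarity L r" "set xs \<subseteq> univ M" for r xs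
  proof -
    have "rint M r xs \<longleftrightarrow> rint N r (map h xs)"
      using assms(1) that by (auto simp: embedding_def)
    moreover have "rint N r (map h xs) \<longleftrightarrow> rint K r (map k (map h xs))"
      using assms(2) that sub[OF that(3)] unfolding embedding_def by (metis length_map)
    ultimately show ?thesis by simp
  qed
  have "inj_on (k \<circ> h) (univ M)"
    using assms unfolding embedding_def
    by (intro comp_inj_on) (auto intro: inj_on_subset)
  then show ?thesis
    using assms fn rl unfolding embedding_def by auto
qed

lemma embedding_restrict_codomain:
  assumes "embedding L N M h" "h ` univ N \<subseteq> X" "is_structure L (M\<lparr>univ := X\<rparr>)"
  shows "embedding L N (M\<lparr>univ := X\<rparr>) h"
  using assms by (auto simp: embedding_def)

lemma embedding_restrict:
  assumes "is_structure L M" "is_structure L (M\<lparr>univ := X\<rparr>)" "X \<subseteq> univ M"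
  shows "embedding L (M\<lparr>univ := X\<rparr>) M (\<lambda>x. x)"
  using assms by (auto simp: embedding_def)

lemma substructure_restrict:
  assumes "is_structure L M" "is_structure L (M\<lparr>univ := X\<rparr>)" "X \<subseteq> univ M"
  shows "substructure L (M\<lparr>univ := X\<rparr>) M"
  using embedding_restrict[OF assms] assms(3) by (auto simp: substructure_def)

lemma isomorphism_inv:
  assumes "isomorphism L M N h"
  shows "isomorphism L N M (inv_into (univ M) h)"
proof -
  let ?k = "inv_into (univ M) h"
  have h: "embedding L M N h" "h ` univ M = univ N" "inj_on h (univ M)"
    using assms by (auto simp: isomorphism_def embedding_def)
  have hk: "h (?k y) = y" "?k y \<in> univ M" if "y \<in> univ N" for y
    using that h(2) by (auto simp: f_inv_into_f inv_into_into)
  have kh: "?k (h x) = x" if "x \<in> univ M" for x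
    using that h(3) by auto
  have lst: "map h (map ?k ys) = ys" "set (map ?k ys) \<subseteq> univ M" if "set ys \<subseteq> univ N" for ys
    using that hk by (auto intro!: map_idI)
  have fn: "?k (fint N f ys) = fint M f (map ?k ys)"
    if "f \<in> fsyms L" "length ys = farity L f" "set ys \<subseteq> univ N" for f ys
  proof -
    have "h (fint M f (map ?k ys)) = fint N f (map h (map ?k ys))"
      using h(1) that lst(2)[OF that(3)] unfolding embedding_def by (metis length_map)
    moreover have "fint M f (map ?k ys) \<in> univ M"
      using embedding_structure(1)[OF h(1)] that lst(2)[OF that(3)]
      unfolding is_structure_def by (metis length_map)
    ultimately show ?thesis using kh lst(1)[OF that(3)] by metis
  qed
  have rl: "rint N r ys \<longleftrightarrow> rint M r (map ?k ys)"
    if "r \<in> rsyms L" "length ys = rarity L r" "set ys \<subseteq> univ N" for r ys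
    using h(1) that lst[OF that(3)] unfolding embedding_def by (metis length_map)
  have "inj_on ?k (univ N)"
    using h(2) by (auto intro: inj_on_inv_into)
  moreover have "?k ` univ N = univ M"
    unfolding h(2)[symmetric] using h(3) by simp
  ultimately show ?thesis
    using embedding_structure[OF h(1)] hk fn rl unfolding isomorphism_def embedding_def by auto
qed

text \<open>Only values on the universe matter. Automorphisms are extensional, so the identity,
  inverses and composites have to be exchanged for their restrictions to the universe before they
  are members of \<open>Aut\<close>.\<close>

lemma isomorphism_cong:
  assumes "isomorphism L M N h" "\<And>x. x \<in> univ M \<Longrightarrow> k x = h x"
  shows "isomorphism L M N k"
proof -
  have h: "embedding L M N h" "h ` univ M = univ N" using assms(1) by (auto simp: isomorphism_def)
  have map: "map k xs = map h xs" if "set xs \<subseteq> univ M" for xs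
    using that assms(2) by auto
  have fn: "k (fint M f xs) = fint N f (map k xs)"
    if "f \<in> fsyms L" "length xs = farity L f" "set xs \<subseteq> univ M" for f xs
  proof -
    have "fint M f xs \<in> univ M"
      using that embedding_structure(1)[OF h(1)] by (auto simp: is_structure_def)
    then show ?thesis unfolding map[OF that(3)] using that h(1) assms(2) by (simp add: embedding_def)
  qed
  have rl: "rint M r xs \<longleftrightarrow> rint N r (map k xs)"
    if "r \<in> rsyms L" "length xs = rarity L r" "set xs \<subseteq> univ M" for r xs
    unfolding map[OF that(3)] using that h(1) by (simp add: embedding_def)
  have "inj_on k (univ M)" "k ` univ M = univ N"
    using h assms(2) by (auto simp: embedding_def cong: inj_on_cong)
  then show ?thesis
    using fn rl embedding_structure[OF h(1)] unfolding isomorphism_def embedding_def by auto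
qed

section \<open>Generated substructures\<close>

lemma generated_subset:
  assumes "is_structure L M" "A \<subseteq> univ M"
  shows "generated L M A \<subseteq> univ M"
proof
  fix x assume "x \<in> generated L M A"
  then show "x \<in> univ M"
    by induction (use assms in \<open>auto simp: is_structure_def subset_iff\<close>)
qed

lemma is_structure_generated: "is_structure L (M\<lparr>univ := generated L M A\<rparr>)"
  by (auto simp: is_structure_def intro: generated.app)

text \<open>Generation consults \<open>fint\<close> only, which the update of \<open>univ\<close>
  leaves alone.\<close>

lemma generated_restrict:
  "generated L (M\<lparr>univ := X\<rparr>) A = generated L M A"
proof
  show "generated L (M\<lparr>univ := X\<rparr>) A \<subseteq> generated L M A"
  proof
    fix x assume "x \<in> generated L (M\<lparr>univ := X\<rparr>) A"
    then show "x \<in> generated L M A"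
      by induction (auto intro: generated.base generated.app)
  qed
  show "generated L M A \<subseteq> generated L (M\<lparr>univ := X\<rparr>) A"
  proof
    fix x assume "x \<in> generated L M A"
    then show "x \<in> generated L (M\<lparr>univ := X\<rparr>) A"
    proof induction
      case (app f xs)
      then show ?case using generated.app[of f L xs "M\<lparr>univ := X\<rparr>" A] by simp
    qed (rule generated.base)
  qed
qed

lemma generated_mono: "A \<subseteq> B \<Longrightarrow> generated L M A \<subseteq> generated L M B"
proof
  fix x assume "A \<subseteq> B" "x \<in> generated L M A"
  from this(2) show "x \<in> generated L M B"
    by induction (use \<open>A \<subseteq> B\<close> in \<open>auto intro: generated.intros\<close>)
qed

lemma finitely_generated_generated:
  assumes "finite A"
  shows "finitely_generated L (M\<lparr>univ := generated L M A\<rparr>)"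
  unfolding finitely_generated_def using assms generated.base[of _ A L M]
  by (intro exI[of _ A]) (auto simp: generated_restrict)

text \<open>An embedding commutes with the function symbols, so both inclusions go by induction on
  generation. Hence finite generation passes to images.\<close>

lemma generated_image:
  assumes "embedding L N M h" "A \<subseteq> univ N"
  shows "generated L M (h ` A) = h ` generated L N A"
proof
  have sub: "generated L N A \<subseteq> univ N"
    using generated_subset[OF embedding_structure(1)[OF assms(1)] assms(2)] .
  have fn: "h (fint N f xs) = fint M f (map h xs)"
    if "f \<in> fsyms L" "length xs = farity L f" "\<forall>x\<in>set xs. x \<in> generated L N A" for f xs
  proof -
    have "set xs \<subseteq> univ N" using that(3) sub by auto
    then show ?thesis using assms(1) that(1,2) unfolding embedding_def by simp
  qed
  show "generated L M (h ` A) \<subseteq> h ` generated L N A"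
  proof
    fix x assume "x \<in> generated L M (h ` A)"
    then show "x \<in> h ` generated L N A"
    proof induction
      case (app f xs)
      \<comment> \<open>\<open>lists_image\<close> chooses preimages for all entries of the argument
        list at once.\<close>
      then have "xs \<in> map h ` lists (generated L N A)"
        unfolding lists_image[symmetric] by (auto simp: in_lists_conv_set)
      then obtain ys where ys: "xs = map h ys" "\<forall>y\<in>set ys. y \<in> generated L N A"
        by (auto simp: in_lists_conv_set)
      then have "fint M f xs = h (fint N f ys)"
        using fn[of f ys] app by simp
      moreover have "fint N f ys \<in> generated L N A"
        using ys app by (intro generated.app) auto
      ultimately show ?case by simp
    qed (auto intro: generated.base)
  qed
  show "h ` generated L N A \<subseteq> generated L M (h ` A)"
  proof clarify
    fix x assume "x \<in> generated L N A"
    then show "h x \<in> generated L M (h ` A)"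
    proof induction
      case (app f xs)
      then have "h (fint N f xs) = fint M f (map h xs)" by (intro fn) auto
      also have "\<dots> \<in> generated L M (h ` A)"
        using app by (intro generated.app) auto
      finally show ?case .
    qed (auto intro: generated.base)
  qed
qed

section \<open>The age, its hereditary property and joint embedding\<close>

text \<open>Inverting the isomorphism and then including the substructure gives an embedding into
  \<open>M\<close>. Conversely, the image of an embedding is the substructure generated by the
  images of the finitely many generators.\<close>

lemma Age_iff:
  assumes "is_structure L M"
  shows "N \<in> Age L M \<longleftrightarrow> finitely_generated L N \<and> (\<exists>h. embedding L N M h)"
proof
  assume "N \<in> Age L M"
  then obtain S h where S: "substructure L S M" "finitely_generated L S" "isomorphism L S N h"
    by (auto simp: Age_def)
  obtain A where A: "finite A" "A \<subseteq> univ S" "generated L S A = univ S"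
    using S(2) by (auto simp: finitely_generated_def)
  have h: "embedding L S N h" "h ` univ S = univ N"
    using S(3) by (auto simp: isomorphism_def)
  have "generated L N (h ` A) = univ N"
    using generated_image[OF h(1) A(2)] A(3) h(2) by simp
  then have "finitely_generated L N"
    unfolding finitely_generated_def unfolding h(2)[symmetric] using A by (intro exI[of _ "h ` A"]) auto
  moreover have "embedding L N M ((\<lambda>x. x) \<circ> inv_into (univ S) h)"
    using isomorphism_inv[OF S(3)] S(1)
    by (intro embedding_comp[of _ _ S]) (auto simp: isomorphism_def substructure_def)
  ultimately show "finitely_generated L N \<and> (\<exists>h. embedding L N M h)" by blast
next
  assume "finitely_generated L N \<and> (\<exists>h. embedding L N M h)"
  then obtain A h where A: "finite A" "A \<subseteq> univ N" "generated L N A = univ N"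
    and h: "embedding L N M h"
    by (auto simp: finitely_generated_def)
  let ?S = "M\<lparr>univ := generated L M (h ` A)\<rparr>"
  have im: "h ` univ N = generated L M (h ` A)"
    using generated_image[OF h A(2)] A(3) by simp
  have "h ` univ N \<subseteq> univ M" using h by (auto simp: embedding_def)
  then have "substructure L ?S M"
    using im by (intro substructure_restrict assms is_structure_generated) auto
  moreover have "finitely_generated L ?S"
    using A(1) by (intro finitely_generated_generated) auto
  moreover have "isomorphism L N ?S h"
    unfolding isomorphism_def
    using im by (intro conjI embedding_restrict_codomain h is_structure_generated) auto
  then have "isomorphism L ?S N (inv_into (univ N) h)"
    by (rule isomorphism_inv)
  ultimately show "N \<in> Age L M" unfolding Age_def by blast
qed

lemma generated_in_Age:
  assumes "is_structure L M" "finite A" "A \<subseteq> univ M"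
  shows "M\<lparr>univ := generated L M A\<rparr> \<in> Age L M"
  unfolding Age_iff[OF assms(1)]
  using finitely_generated_generated[OF assms(2)]
    embedding_restrict[OF assms(1) is_structure_generated generated_subset[OF assms(1,3)]]
  by blast

lemma HP_Age:
  assumes "is_structure L M"
  shows "HP L (Age L M)"
  unfolding HP_def substructure_def using embedding_comp by (fastforce simp: Age_iff[OF assms])

text \<open>Both members embed in \<open>M\<close>, and the images of their finite generating sets
  together generate a finitely generated substructure that contains both embedded copies.\<close>

lemma JEP_Age:
  assumes M: "is_structure L M"
  shows "JEP L (Age L M)"
  unfolding JEP_def
proof (intro ballI)
  fix N1 N2 assume "N1 \<in> Age L M" "N2 \<in> Age L M"
  then obtain h1 h2 A1 A2 where h: "embedding L N1 M h1" "embedding L N2 M h2"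
    and A: "finite A1" "A1 \<subseteq> univ N1" "generated L N1 A1 = univ N1"
      "finite A2" "A2 \<subseteq> univ N2" "generated L N2 A2 = univ N2"
    unfolding Age_iff[OF M] finitely_generated_def by auto
  let ?B = "h1 ` A1 \<union> h2 ` A2"
  let ?N = "M\<lparr>univ := generated L M ?B\<rparr>"
  have "?B \<subseteq> univ M" using h A unfolding embedding_def by auto
  then have "?N \<in> Age L M" using A by (intro generated_in_Age M) auto
  moreover have "embedding L N1 ?N h1"
    using generated_image[OF h(1) A(2)] A(3) generated_mono[of "h1 ` A1" ?B L M]
    by (intro embedding_restrict_codomain h is_structure_generated) auto
  moreover have "embedding L N2 ?N h2"
    using generated_image[OF h(2) A(5)] A(6) generated_mono[of "h2 ` A2" ?B L M]
    by (intro embedding_restrict_codomain h is_structure_generated) auto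
  ultimately show "\<exists>N\<in>Age L M. (\<exists>h. embedding L N1 N h) \<and> (\<exists>h'. embedding L N2 N h')"
    by blast
qed

section \<open>Quantifier-free types\<close>

lemma trm_val_embedding:
  assumes "embedding L M N h" "set as \<subseteq> univ M" "wf_trm L (length as) t"
  shows "trm_val M as t \<in> univ M \<and> trm_val N (map h as) t = h (trm_val M as t)"
  using assms(3)
proof (induction t)
  case (Var i)
  then show ?case using assms(2) by auto
next
  case (Fun f ts)
  then have ts: "f \<in> fsyms L" "length (map (trm_val M as) ts) = farity L f"
    "\<forall>t\<in>set ts. trm_val M as t \<in> univ M \<and> trm_val N (map h as) t = h (trm_val M as t)"
    by (auto simp: list_all_iff)
  then have sub: "set (map (trm_val M as) ts) \<subseteq> univ M" by auto
  have "map (trm_val N (map h as)) ts = map h (map (trm_val M as) ts)"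
    using ts by auto
  then show ?case
    using embedding_structure(1)[OF assms(1)] assms(1) ts sub
    unfolding is_structure_def embedding_def trm_val.simps by metis
qed

lemma sat_embedding:
  assumes "embedding L M N h" "set as \<subseteq> univ M" "wf_qff L (length as) p"
  shows "sat N (map h as) p \<longleftrightarrow> sat M as p"
  using assms(3)
proof (induction p)
  case (Eql s t)
  have "inj_on h (univ M)" using assms(1) by (auto simp: embedding_def)
  then show ?case
    using trm_val_embedding[OF assms(1,2)] Eql by (auto dest: inj_onD)
next
  case (Rel r ts)
  have ts: "\<forall>t\<in>set ts. trm_val M as t \<in> univ M \<and> trm_val N (map h as) t = h (trm_val M as t)"
    using trm_val_embedding[OF assms(1,2)] Rel by (auto simp: list_all_iff)
  then have "set (map (trm_val M as) ts) \<subseteq> univ M"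
    "map (trm_val N (map h as)) ts = map h (map (trm_val M as) ts)"
    by auto
  moreover have "length (map (trm_val M as) ts) = rarity L r" "r \<in> rsyms L"
    using Rel by auto
  ultimately show ?case
    using assms(1) unfolding embedding_def sat.simps by metis
qed auto

text \<open>In particular a tuple has the same type in a substructure as in \<open>M\<close>, which
  later lets the Ramsey arrow move between \<open>M\<close> and members of its age.\<close>

lemma qftp_embedding:
  assumes "embedding L M N h" "set as \<subseteq> univ M"
  shows "qftp L N (map h as) = qftp L M as"
  using sat_embedding[OF assms] by (auto simp: qftp_def)

text \<open>Naming the generated elements by terms makes them accessible to quantifier-free
  formulas.\<close>

lemma generated_eq_trm_val:
  "generated L M (set as) = trm_val M as ` {t. wf_trm L (length as) t}"
proof
  show "generated L M (set as) \<subseteq> trm_val M as ` {t. wf_trm L (length as) t}"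
  proof
    fix x assume "x \<in> generated L M (set as)"
    then show "x \<in> trm_val M as ` {t. wf_trm L (length as) t}"
    proof induction
      case (base x)
      then obtain i where "i < length as" "x = as ! i" by (auto simp: in_set_conv_nth)
      then show ?case by (intro image_eqI[of _ _ "Var i"]) auto
    next
      case (app f xs)
      then have "xs \<in> map (trm_val M as) ` lists {t. wf_trm L (length as) t}"
        unfolding lists_image[symmetric] by (auto simp: in_lists_conv_set)
      then obtain ts where "xs = map (trm_val M as) ts" "list_all (wf_trm L (length as)) ts"
        by (auto simp: in_lists_conv_set list_all_iff)
      then show ?case
        using app by (intro image_eqI[of _ _ "Fun f ts"]) auto
    qed
  qed
  have "trm_val M as t \<in> generated L M (set as)" if "wf_trm L (length as) t" for t
    using that
  proof (induction t)
    case (Fun f ts)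
    then show ?case unfolding trm_val.simps by (intro generated.app) (auto simp: list_all_iff)
  qed (auto intro: generated.base)
  then show "trm_val M as ` {t. wf_trm L (length as) t} \<subseteq> generated L M (set as)"
    by auto
qed

text \<open>The value of a term at \<open>as\<close> is sent to the value of the same term at
  \<open>bs\<close>. The equations in the common type make this well defined and injective, its
  relational atoms take care of the relations, and compound terms of the function symbols.\<close>

lemma qftp_eq_imp_isomorphism:
  assumes M: "is_structure L M" and N: "is_structure L N"
    and as: "set as \<subseteq> univ M" and bs: "set bs \<subseteq> univ N" and len: "length bs = length as"
    and eq: "qftp L N bs = qftp L M as"
  obtains h where "isomorphism L (M\<lparr>univ := generated L M (set as)\<rparr>)
      (N\<lparr>univ := generated L N (set bs)\<rparr>) h" "map h as = bs"
proof -
  let ?W = "{t. wf_trm L (length as) t}"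
  \<comment> \<open>The choice selects some term that names \<open>x\<close>; by
    \<open>val_eq\<close> below, the result does not depend on which one.\<close>
  define h where "h x = trm_val N bs (SOME t. t \<in> ?W \<and> trm_val M as t = x)" for x
  have sat: "sat N bs p \<longleftrightarrow> sat M as p" if "wf_qff L (length as) p" for p
    using eq that len unfolding qftp_def by (metis (mono_tags, lifting) mem_Collect_eq)
  have val_eq: "trm_val N bs s = trm_val N bs t \<longleftrightarrow> trm_val M as s = trm_val M as t"
    if "s \<in> ?W" "t \<in> ?W" for s t
    using sat[of "Eql s t"] that by simp
  have h: "h (trm_val M as t) = trm_val N bs t" if "t \<in> ?W" for t
  proof -
    have "\<exists>s. s \<in> ?W \<and> trm_val M as s = trm_val M as t" using that by blast
    from someI_ex[OF this] val_eq[of _ t] that show ?thesis unfolding h_def by blast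
  qed
  have gen: "generated L M (set as) = trm_val M as ` ?W" "generated L N (set bs) = trm_val N bs ` ?W"
    using generated_eq_trm_val[of L M as] generated_eq_trm_val[of L N bs] len by auto
  have lift: "\<exists>ts. xs = map (trm_val M as) ts \<and> map h xs = map (trm_val N bs) ts \<and> list_all (wf_trm L (length as)) ts"
    if "set xs \<subseteq> generated L M (set as)" for xs
  proof -
    have "xs \<in> map (trm_val M as) ` lists ?W"
      using that unfolding lists_image[symmetric] gen by (auto simp: in_lists_conv_set)
    then obtain ts where "xs = map (trm_val M as) ts" "list_all (wf_trm L (length as)) ts"
      by (auto simp: in_lists_conv_set list_all_iff)
    then show ?thesis using h by (intro exI[of _ ts]) (auto simp: list_all_iff)
  qed
  have fn: "h (fint M f xs) = fint N f (map h xs)"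
    if xs: "f \<in> fsyms L" "length xs = farity L f" "set xs \<subseteq> generated L M (set as)" for f xs
  proof -
    obtain ts where ts: "xs = map (trm_val M as) ts" "map h xs = map (trm_val N bs) ts"
      "list_all (wf_trm L (length as)) ts"
      using lift[OF xs(3)] by blast
    then have "Fun f ts \<in> ?W" using xs by auto
    from h[OF this] show ?thesis unfolding ts(2) by (simp add: ts(1))
  qed
  have rl: "rint M r xs \<longleftrightarrow> rint N r (map h xs)"
    if xs: "r \<in> rsyms L" "length xs = rarity L r" "set xs \<subseteq> generated L M (set as)" for r xs
  proof -
    obtain ts where ts: "xs = map (trm_val M as) ts" "map h xs = map (trm_val N bs) ts"
      "list_all (wf_trm L (length as)) ts"
      using lift[OF xs(3)] by blast
    then have "wf_qff L (length as) (Rel r ts)" using xs by auto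
    from sat[OF this] show ?thesis unfolding ts(2) by (simp add: ts(1))
  qed
  have "h ` generated L M (set as) = generated L N (set bs)"
    unfolding gen image_image using h by (intro image_cong) auto
  moreover have "inj_on h (generated L M (set as))"
    unfolding gen using h val_eq by (auto simp: inj_on_def)
  ultimately have "isomorphism L (M\<lparr>univ := generated L M (set as)\<rparr>)
      (N\<lparr>univ := generated L N (set bs)\<rparr>) h"
    using fn rl unfolding isomorphism_def embedding_def
    by (auto simp: is_structure_generated)
  moreover have "map h as = bs"
  proof (rule nth_equalityI)
    fix i assume "i < length (map h as)"
    then show "map h as ! i = bs ! i" using h[of "Var i"] by simp
  qed (simp add: len)
  ultimately show ?thesis by (rule that)
qed

section \<open>Transport of copies and of the Ramsey arrow\<close>

text \<open>Stated for a mere left inverse \<open>\<phi>'\<close> and type-preserving maps, so that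
  it serves in both directions: for pushing copies forward and, with the roles of the structures
  exchanged, for pulling them back.\<close>

lemma copies_map:
  assumes \<phi>': "\<And>x. x \<in> A \<Longrightarrow> \<phi>' (\<phi> x) = x"
    and \<phi>: "\<And>as. set as \<subseteq> A \<Longrightarrow> qftp L M' (map \<phi> as) = qftp L M as"
    and \<psi>: "\<And>cs. set cs \<subseteq> C \<Longrightarrow> qftp L N' (map \<psi> cs) = qftp L N cs"
    and f: "f \<in> copies L M A N C"
  shows "(\<lambda>x\<in>\<phi> ` A. \<psi> (f (\<phi>' x))) \<in> copies L M' (\<phi> ` A) N' (\<psi> ` C)"
proof -
  obtain as where as: "distinct as" "set as = A" "qftp L N (map f as) = qftp L M as"
    and fC: "f \<in> A \<rightarrow>\<^sub>E C"
    using f by (auto simp: copies_def)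
  let ?g = "\<lambda>x\<in>\<phi> ` A. \<psi> (f (\<phi>' x))"
  have "inj_on \<phi> A" using \<phi>' by (metis inj_onI)
  then have "distinct (map \<phi> as)" using as by (simp add: distinct_map)
  moreover have "set (map \<phi> as) = \<phi> ` A" using as(2) by simp
  moreover have "qftp L N' (map ?g (map \<phi> as)) = qftp L M' (map \<phi> as)"
  proof -
    have "set (map f as) \<subseteq> C" using fC as(2) by auto
    then have "qftp L N' (map \<psi> (map f as)) = qftp L N (map f as)" by (rule \<psi>)
    also have "\<dots> = qftp L M' (map \<phi> as)" using \<phi>[of as] as(2,3) by simp
    also have "map \<psi> (map f as) = map ?g (map \<phi> as)" using as(2) \<phi>' by simp
    finally show ?thesis .
  qed
  moreover have "?g \<in> \<phi> ` A \<rightarrow>\<^sub>E \<psi> ` C" using fC \<phi>' by auto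
  ultimately show ?thesis unfolding copies_def by blast
qed

text \<open>The arrow depends on quantifier-free types only: a colouring on the target side is
  pulled back along \<open>up\<close>, and the copy of \<open>B\<close> found for it is pushed
  forward.\<close>

lemma ramsey_arrow_transfer:
  assumes inj: "inj_on \<phi> (A \<union> B)" "inj_on \<psi> C"
    and \<phi>: "\<And>as. set as \<subseteq> A \<union> B \<Longrightarrow> qftp L M' (map \<phi> as) = qftp L M as"
    and \<psi>: "\<And>cs. set cs \<subseteq> C \<Longrightarrow> qftp L N' (map \<psi> cs) = qftp L N cs"
    and arrow: "ramsey_arrow L M A B N C"
  shows "ramsey_arrow L M' (\<phi> ` A) (\<phi> ` B) N' (\<psi> ` C)"
  unfolding ramsey_arrow_def
proof
  fix k' assume k': "k' \<in> copies L M' (\<phi> ` A) N' (\<psi> ` C) \<rightarrow> {0, 1 :: nat}"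
  define \<phi>' where "\<phi>' = inv_into (A \<union> B) \<phi>"
  define \<psi>' where "\<psi>' = inv_into C \<psi>"
  have \<phi>' [simp]: "\<phi>' (\<phi> x) = x" if "x \<in> A \<or> x \<in> B" for x
    using inj(1) that by (simp add: \<phi>'_def)
  have \<psi>' [simp]: "\<psi>' (\<psi> x) = x" if "x \<in> C" for x
    using inj(2) that by (simp add: \<psi>'_def)
  have \<phi>'_A: "\<phi>' ` \<phi> ` A = A" and \<psi>'_C: "\<psi>' ` \<psi> ` C = C"
    by (auto simp: image_image)
  have \<phi>'_qftp: "qftp L M (map \<phi>' as) = qftp L M' as" if "set as \<subseteq> \<phi> ` A" for as
  proof -
    have "map \<phi> (map \<phi>' as) = as" "set (map \<phi>' as) \<subseteq> A \<union> B" using that by (auto intro!: map_idI)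
    then show ?thesis using \<phi>[of "map \<phi>' as"] by metis
  qed
  have \<psi>'_qftp: "qftp L N (map \<psi>' cs) = qftp L N' cs" if "set cs \<subseteq> \<psi> ` C" for cs
  proof -
    have "map \<psi> (map \<psi>' cs) = cs" "set (map \<psi>' cs) \<subseteq> C" using that by (auto intro!: map_idI)
    then show ?thesis using \<psi>[of "map \<psi>' cs"] by metis
  qed
  define up where "up f = (\<lambda>x\<in>\<phi> ` A. \<psi> (f (\<phi>' x)))" for f
  have "up f \<in> copies L M' (\<phi> ` A) N' (\<psi> ` C)" if "f \<in> copies L M A N C" for f
    unfolding up_def by (rule copies_map) (use \<phi> \<psi> that in \<open>auto simp: le_supI1\<close>)
  then have "(\<lambda>f. k' (up f)) \<in> copies L M A N C \<rightarrow> {0, 1}" using k' by (simp add: Pi_iff)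
  then obtain e c where e: "e \<in> copies L M B N C"
    and c: "\<And>f. f \<in> copies L M A N C \<Longrightarrow> f ` A \<subseteq> e ` B \<Longrightarrow> k' (up f) = c"
    using arrow unfolding ramsey_arrow_def by (metis (no_types, lifting))
  have eC: "e x \<in> C" if "x \<in> B" for x using e that by (auto simp: copies_def)
  let ?e' = "\<lambda>x\<in>\<phi> ` B. \<psi> (e (\<phi>' x))"
  have "?e' \<in> copies L M' (\<phi> ` B) N' (\<psi> ` C)"
    by (rule copies_map) (use \<phi> \<psi> e in \<open>auto simp: le_supI2\<close>)
  moreover have "k' f' = c"
    if f': "f' \<in> copies L M' (\<phi> ` A) N' (\<psi> ` C)" and sub: "f' ` \<phi> ` A \<subseteq> ?e' ` \<phi> ` B" for f'
  proof -
    \<comment> \<open>Each copy on the target side is \<open>up f\<close> for the copy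
      \<open>f\<close> obtained from the inverse maps, so the pulled back colouring sees all of
      them.\<close>
    define f where "f = (\<lambda>x\<in>\<phi>' ` \<phi> ` A. \<psi>' (f' (\<phi> x)))"
    have "f \<in> copies L M (\<phi>' ` \<phi> ` A) N (\<psi>' ` \<psi> ` C)"
      unfolding f_def by (rule copies_map) (use \<phi>'_qftp \<psi>'_qftp f' in auto)
    then have f: "f \<in> copies L M A N C" unfolding \<phi>'_A \<psi>'_C .
    have f_app: "f x = \<psi>' (f' (\<phi> x))" if "x \<in> A" for x
      using that by (simp add: f_def \<phi>'_A)
    have "f x \<in> e ` B" if x: "x \<in> A" for x
    proof -
      have "f' (\<phi> x) \<in> ?e' ` \<phi> ` B" using sub x by auto
      then obtain b where "b \<in> B" "f' (\<phi> x) = \<psi> (e b)" by auto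
      then show ?thesis using f_app[OF x] eC by auto
    qed
    then have "k' (up f) = c" using c[OF f] by auto
    moreover have "up f = f'"
    proof (rule extensionalityI[of _ "\<phi> ` A"])
      show "f' \<in> extensional (\<phi> ` A)" using f' by (auto simp: copies_def PiE_def)
      fix y assume "y \<in> \<phi> ` A"
      then obtain x where x: "x \<in> A" "y = \<phi> x" by auto
      have "f' y \<in> \<psi> ` C" using f' x by (auto simp: copies_def)
      then show "up f y = f' y" using x f_app by (auto simp: up_def)
    qed (simp add: up_def)
    ultimately show ?thesis by simp
  qed
  ultimately show "\<exists>e\<in>copies L M' (\<phi> ` B) N' (\<psi> ` C). \<exists>c. \<forall>f\<in>copies L M' (\<phi> ` A) N' (\<psi> ` C).
      f ` \<phi> ` A \<subseteq> e ` \<phi> ` B \<longrightarrow> k' f = c"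
    by (intro bexI[of _ ?e'] exI[of _ c] ballI impI)
qed

section \<open>Extremely amenable permutation groups\<close>

text \<open>\<open>group_action\<close> demands a homomorphism into \<open>BijGroup\<close>.
  Bijectivity comes for free from the action of the inverse; extensionality has to be
  supplied.\<close>

lemma group_actionI:
  assumes "group G"
    and closed: "\<And>g x. g \<in> carrier G \<Longrightarrow> x \<in> E \<Longrightarrow> \<phi> g x \<in> E"
    and ext: "\<And>g. g \<in> carrier G \<Longrightarrow> \<phi> g \<in> extensional E"
    and one: "\<And>x. x \<in> E \<Longrightarrow> \<phi> \<one>\<^bsub>G\<^esub> x = x"
    and mult: "\<And>g h x. g \<in> carrier G \<Longrightarrow> h \<in> carrier G \<Longrightarrow> x \<in> E \<Longrightarrow>
      \<phi> (g \<otimes>\<^bsub>G\<^esub> h) x = \<phi> g (\<phi> h x)"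
  shows "group_action G E \<phi>"
proof -
  interpret group G by fact
  have inv: "\<phi> (inv\<^bsub>G\<^esub> g) (\<phi> g x) = x" "\<phi> g (\<phi> (inv\<^bsub>G\<^esub> g) x) = x"
    if "g \<in> carrier G" "x \<in> E" for g x
    using that mult[of "inv\<^bsub>G\<^esub> g" g x] mult[of g "inv\<^bsub>G\<^esub> g" x] one by auto
  have Bij: "\<phi> g \<in> Bij E" if "g \<in> carrier G" for g
  proof -
    have "bij_betw (\<phi> g) E E"
      by (rule bij_betw_byWitness[where f' = "\<phi> (inv\<^bsub>G\<^esub> g)"]) (use that inv closed in auto)
    then show ?thesis using ext[OF that] by (simp add: Bij_def)
  qed
  have "\<phi> (g \<otimes>\<^bsub>G\<^esub> h) = \<phi> g \<otimes>\<^bsub>BijGroup E\<^esub> \<phi> h" if "g \<in> carrier G" "h \<in> carrier G" for g h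
  proof -
    have "\<phi> (g \<otimes>\<^bsub>G\<^esub> h) = compose E (\<phi> g) (\<phi> h)"
      using that mult ext[of "g \<otimes>\<^bsub>G\<^esub> h"]
      by (intro extensionalityI[of _ E]) (auto simp: compose_def)
    then show ?thesis using that Bij by (simp add: BijGroup_def)
  qed
  then have "\<phi> \<in> hom G (BijGroup E)"
    using Bij by (intro homI) (auto simp: BijGroup_def)
  then show ?thesis
    by (intro group_action.intro group_hom.intro group_hom_axioms.intro assms group_BijGroup)
qed

text \<open>A space on the smaller type is copied along \<open>j\<close>, and the fixed point found
  in the copy is carried back. This bridges the type of colourings and the type of sets of
  sets.\<close>

lemma extremely_amenable_transfer:
  fixes j :: "'b \<Rightarrow> 'a"
  assumes j: "inj j" and EA: "extremely_amenable TYPE('a) G T"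
  shows "extremely_amenable TYPE('b) G T"
  unfolding extremely_amenable_def
proof (intro allI impI)
  fix X :: "'b topology" and \<phi>
  assume *: "topspace X \<noteq> {} \<and> compact_space X \<and> Hausdorff_space X \<and> continuous_action G T X \<phi>"
  then interpret act: group_action G "topspace X" \<phi> by (simp add: continuous_action_def)
  interpret group G using act.group_hom group_hom.axioms(1) by blast
  define k where "k = inv_into UNIV j"
  have kj [simp]: "k (j x) = x" for x using j by (simp add: k_def)
  \<comment> \<open>Pulling the topology back along the left inverse \<open>k\<close> of
    \<open>j\<close> makes \<open>j\<close> a homeomorphism from \<open>X\<close> onto
    \<open>Y\<close>.\<close>
  define Y where "Y = pullback_topology (j ` topspace X) k X"
  have top: "topspace Y = j ` topspace X"
    by (auto simp: Y_def topspace_pullback_topology)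
  have j_cont: "continuous_map X Y j"
    unfolding Y_def by (rule continuous_map_pullback') (auto simp: comp_def)
  have k_cont: "continuous_map Y X k"
    using continuous_map_pullback[of X X id "j ` topspace X" k] by (simp add: Y_def)
  have "homeomorphic_maps X Y j k"
    unfolding homeomorphic_maps_def using j_cont k_cont by (auto simp: top)
  then have "X homeomorphic_space Y" by (auto simp: homeomorphic_space_def)
  then have Y: "topspace Y \<noteq> {}" "compact_space Y" "Hausdorff_space Y"
    using * homeomorphic_compact_space homeomorphic_Hausdorff_space top by auto
  define \<psi> where "\<psi> g = restrict (\<lambda>y. j (\<phi> g (k y))) (topspace Y)" for g
  have "group_action G (topspace Y) \<psi>"
  proof (rule group_actionI)
    show "group G" ..
    show "\<psi> g y \<in> topspace Y" if "g \<in> carrier G" "y \<in> topspace Y" for g y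
      using that act.element_image by (auto simp: \<psi>_def top)
    show "\<psi> g \<in> extensional (topspace Y)" for g
      by (simp add: \<psi>_def)
    show "\<psi> \<one>\<^bsub>G\<^esub> y = y" if "y \<in> topspace Y" for y
      using that by (auto simp: \<psi>_def top simp flip: act.id_eq_one)
    show "\<psi> (g \<otimes>\<^bsub>G\<^esub> h) y = \<psi> g (\<psi> h y)"
      if "g \<in> carrier G" "h \<in> carrier G" "y \<in> topspace Y" for g h y
      using that act.element_image[OF that(2)] by (auto simp: \<psi>_def top act.composition_rule)
  qed
  moreover have "continuous_map (prod_topology T Y) Y (\<lambda>(g, y). \<psi> g y)"
  proof -
    have "continuous_map (prod_topology T Y) (prod_topology T X) (\<lambda>(g, y). (g, k y))"
      using k_cont by (simp add: continuous_map_prod_top)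
    moreover have "continuous_map (prod_topology T X) X (\<lambda>(g, x). \<phi> g x)"
      using * by (simp add: continuous_action_def)
    ultimately have "continuous_map (prod_topology T Y) Y (j \<circ> ((\<lambda>(g, x). \<phi> g x) \<circ> (\<lambda>(g, y). (g, k y))))"
      using j_cont by (blast intro: continuous_map_compose)
    then show ?thesis
      by (rule continuous_map_eq) (auto simp: \<psi>_def)
  qed
  ultimately obtain y where y: "y \<in> topspace Y" "\<forall>g\<in>carrier G. \<psi> g y = y"
    using EA Y unfolding extremely_amenable_def continuous_action_def by blast
  then have "\<phi> g (k y) = k y" if "g \<in> carrier G" for g
    using that by (metis kj \<psi>_def restrict_apply')
  moreover have "k y \<in> topspace X" using y(1) top by auto
  ultimately show "\<exists>x\<in>topspace X. \<forall>g\<in>carrier G. \<phi> g x = x" by blast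
qed

section \<open>Permutation groups, restrictions of their elements and the group form of the
  arrow\<close>

locale permutation_group =
  fixes \<Omega> :: "'a set" and H :: "('a \<Rightarrow> 'a) set"
  assumes subgroup: "subgroup H (BijGroup \<Omega>)"
begin

definition G :: "('a \<Rightarrow> 'a) monoid" where
  "G = (BijGroup \<Omega>)\<lparr>carrier := H\<rparr>"

definition T :: "('a \<Rightarrow> 'a) topology" where
  "T = subtopology (product_topology (\<lambda>_. discrete_topology \<Omega>) \<Omega>) H"

text \<open>For \<open>A\<close> contained in \<open>\<Omega>\<close>, restrictions to
  \<open>A\<close> correspond to the left cosets of the pointwise stabiliser of \<open>A\<close> in
  \<open>H\<close>. As extensional functions they can be compared directly with
  \<open>copies\<close>.\<close>

definition restrictions :: "'a set \<Rightarrow> 'a set \<Rightarrow> ('a \<Rightarrow> 'a) set" where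
  "restrictions A C = {f \<in> A \<rightarrow>\<^sub>E C. \<exists>g\<in>H. \<forall>x\<in>A. f x = g x}"

text \<open>The number of colours is a parameter because the fixed point argument needs one colour
  for each member of a finite cover.\<close>

definition arrow :: "nat \<Rightarrow> 'a set \<Rightarrow> 'a set \<Rightarrow> 'a set \<Rightarrow> bool" where
  "arrow r A B C \<longleftrightarrow> (\<forall>\<kappa> \<in> (restrictions A C \<rightarrow> {..<r}).
     \<exists>g\<in>H. g ` B \<subseteq> C \<and> (\<exists>c. \<forall>f \<in> restrictions A (g ` B). \<kappa> f = c))"

definition ramsey :: "nat \<Rightarrow> bool" where
  "ramsey r \<longleftrightarrow> (\<forall>A B. finite A \<and> A \<subseteq> \<Omega> \<and> finite B \<and> B \<subseteq> \<Omega> \<longrightarrow>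
     (\<exists>C. finite C \<and> C \<subseteq> \<Omega> \<and> arrow r A B C))"

lemma ramseyE:
  assumes "ramsey r" "finite A" "A \<subseteq> \<Omega>" "finite B" "B \<subseteq> \<Omega>"
  obtains C where "finite C" "C \<subseteq> \<Omega>" "arrow r A B C"
  using assms unfolding ramsey_def by metis

lemma carrier_G [simp]: "carrier G = H"
  by (simp add: G_def)

sublocale group G
  unfolding G_def by (rule subgroup.subgroup_is_group[OF subgroup group_BijGroup])

lemma H_Bij: "g \<in> H \<Longrightarrow> g \<in> Bij \<Omega>"
  using subgroup.subset[OF subgroup] by (auto simp: BijGroup_def)

lemma app_closed: "g \<in> H \<Longrightarrow> x \<in> \<Omega> \<Longrightarrow> g x \<in> \<Omega>"
  using H_Bij Bij_imp_funcset by blast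

lemma one_app: "x \<in> \<Omega> \<Longrightarrow> \<one>\<^bsub>G\<^esub> x = x"
  by (simp add: G_def BijGroup_def)

lemma mult_app: "g \<in> H \<Longrightarrow> h \<in> H \<Longrightarrow> x \<in> \<Omega> \<Longrightarrow> (g \<otimes>\<^bsub>G\<^esub> h) x = g (h x)"
  by (simp add: G_def BijGroup_def H_Bij compose_eq)

lemma mult_image: "g \<in> H \<Longrightarrow> h \<in> H \<Longrightarrow> B \<subseteq> \<Omega> \<Longrightarrow> (g \<otimes>\<^bsub>G\<^esub> h) ` B = g ` h ` B"
  by (force simp: mult_app)

lemma m_closed_H: "g \<in> H \<Longrightarrow> h \<in> H \<Longrightarrow> g \<otimes>\<^bsub>G\<^esub> h \<in> H"
  using m_closed by simp

lemma inv_closed_H: "g \<in> H \<Longrightarrow> (inv\<^bsub>G\<^esub> g) \<in> H"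
  using inv_closed by simp

lemma one_H: "\<one>\<^bsub>G\<^esub> \<in> H"
  using one_closed by simp

lemma inv_app: "g \<in> H \<Longrightarrow> x \<in> \<Omega> \<Longrightarrow> (inv\<^bsub>G\<^esub> g) (g x) = x"
  using mult_app[of "inv\<^bsub>G\<^esub> g" g x] l_inv[of g] one_app inv_closed_H by simp

lemma app_inv: "g \<in> H \<Longrightarrow> x \<in> \<Omega> \<Longrightarrow> g ((inv\<^bsub>G\<^esub> g) x) = x"
  using mult_app[of g "inv\<^bsub>G\<^esub> g" x] r_inv[of g] one_app inv_closed_H by simp

lemma topspace_T: "topspace T = H"
  using H_Bij Bij_imp_funcset Bij_imp_extensional by (fastforce simp: T_def PiE_def)

lemma restrictions_mono: "C \<subseteq> D \<Longrightarrow> restrictions A C \<subseteq> restrictions A D"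
  by (auto simp: restrictions_def PiE_iff)

lemma restrict_restrictions:
  assumes "g \<in> H" "g ` A \<subseteq> C"
  shows "restrict g A \<in> restrictions A C"
  using assms by (auto simp: restrictions_def)

lemma compose_restrictions:
  assumes "g \<in> H" "f \<in> restrictions A C" "A \<subseteq> \<Omega>"
  shows "compose A g f \<in> restrictions A (g ` C)"
proof -
  obtain h where h: "h \<in> H" "\<forall>x\<in>A. f x = h x" "f \<in> A \<rightarrow>\<^sub>E C"
    using assms by (auto simp: restrictions_def)
  have "\<forall>x\<in>A. compose A g f x = (g \<otimes>\<^bsub>G\<^esub> h) x"
    using h assms by (auto simp: compose_def mult_app)
  then show ?thesis
    using h m_closed_H[OF assms(1) h(1)] by (auto simp: restrictions_def compose_def)
qed

text \<open>Translation by \<open>g\<close> is undone by translation by its inverse, so a colouring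
  of the restrictions into the image of \<open>C\<close> can be studied on \<open>C\<close>
  itself.\<close>

lemma compose_inv_restrictions:
  assumes "g \<in> H" "f \<in> restrictions A (g ` C)" "A \<subseteq> \<Omega>" "C \<subseteq> \<Omega>"
  shows "compose A (inv\<^bsub>G\<^esub> g) f \<in> restrictions A C" "compose A g (compose A (inv\<^bsub>G\<^esub> g) f) = f"
proof -
  have "(inv\<^bsub>G\<^esub> g) ` g ` C = (\<lambda>x. x) ` C"
    unfolding image_image using inv_app[OF assms(1)] assms(4) by (intro image_cong) auto
  then have im: "(inv\<^bsub>G\<^esub> g) ` g ` C = C" by simp
  show "compose A (inv\<^bsub>G\<^esub> g) f \<in> restrictions A C"
    using compose_restrictions[OF inv_closed_H[OF assms(1)] assms(2,3)] unfolding im .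
  have "f x \<in> \<Omega>" if "x \<in> A" for x
  proof -
    have "f x \<in> g ` C" using assms(2) that by (auto simp: restrictions_def)
    then show ?thesis using assms(4) app_closed[OF assms(1)] by auto
  qed
  moreover have "f \<in> extensional A" using assms(2) by (auto simp: restrictions_def PiE_iff)
  ultimately show "compose A g (compose A (inv\<^bsub>G\<^esub> g) f) = f"
    by (intro extensionalityI[of _ A]) (auto simp: compose_def app_inv assms(1))
qed

lemma finite_restrictions: "finite A \<Longrightarrow> finite C \<Longrightarrow> finite (restrictions A C)"
  unfolding restrictions_def by (rule finite_subset[OF _ finite_PiE[of A "\<lambda>_. C"]]) auto

section \<open>From two colours to any positive finite number\<close>

lemma ramsey_one: "ramsey 1"
  unfolding ramsey_def
proof (intro allI impI)
  fix A B :: "'a set" assume *: "finite A \<and> A \<subseteq> \<Omega> \<and> finite B \<and> B \<subseteq> \<Omega>"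
  have "\<one>\<^bsub>G\<^esub> ` B = B" using * one_app by force
  then have "arrow 1 A B B"
    unfolding arrow_def using one_H
    by (intro ballI bexI[of _ "\<one>\<^bsub>G\<^esub>"] conjI exI[of _ 0]) (auto simp: Pi_iff)
  then show "\<exists>C. finite C \<and> C \<subseteq> \<Omega> \<and> arrow 1 A B C" using * by blast
qed

text \<open>First only the distinction between colour \<open>r\<close> and all others is made
  constant, on a translate of a set \<open>D\<close> that handles \<open>r\<close> colours. There
  either the colour is always \<open>r\<close>, or only the colours below \<open>r\<close> are
  left.\<close>

lemma ramsey_Suc:
  assumes two: "ramsey 2" and r: "ramsey r" "r > 0"
  shows "ramsey (Suc r)"
  unfolding ramsey_def
proof (intro allI impI)
  fix A B assume *: "finite A \<and> A \<subseteq> \<Omega> \<and> finite B \<and> B \<subseteq> \<Omega>"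
  then obtain D where D: "finite D" "D \<subseteq> \<Omega>" "arrow r A B D"
    using ramseyE[OF r(1)] by blast
  then obtain C where C: "finite C" "C \<subseteq> \<Omega>" "arrow 2 A D C"
    using ramseyE[OF two] * by blast
  have "arrow (Suc r) A B C"
    unfolding arrow_def
  proof
    fix \<kappa> assume \<kappa>: "\<kappa> \<in> restrictions A C \<rightarrow> {..<Suc r}"
    obtain g c where g: "g \<in> H" "g ` D \<subseteq> C"
      and c: "\<forall>f\<in>restrictions A (g ` D). (if \<kappa> f = r then 1 else 0) = (c :: nat)"
      using bspec[OF C(3)[unfolded arrow_def], of "\<lambda>f. if \<kappa> f = r then 1 else 0"] by auto
    have comp: "compose A g f \<in> restrictions A (g ` D)" if "f \<in> restrictions A D" for f
      using compose_restrictions[OF g(1) that] * by blast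
    show "\<exists>g\<in>H. g ` B \<subseteq> C \<and> (\<exists>c. \<forall>f\<in>restrictions A (g ` B). \<kappa> f = c)"
    proof (cases "c = 1")
      case True
      \<comment> \<open>Here the arrow for \<open>D\<close> merely has to supply a translate of
        \<open>B\<close> inside \<open>D\<close>; the constant colouring is admissible since
        \<open>r > 0\<close>.\<close>
      obtain h where h: "h \<in> H" "h ` B \<subseteq> D"
        using bspec[OF D(3)[unfolded arrow_def], of "\<lambda>_. 0"] r(2) by auto
      have im: "(g \<otimes>\<^bsub>G\<^esub> h) ` B \<subseteq> g ` D"
        using mult_image[OF g(1) h(1)] h(2) * by auto
      then have "\<kappa> f = r" if "f \<in> restrictions A ((g \<otimes>\<^bsub>G\<^esub> h) ` B)" for f
      proof -
        have "f \<in> restrictions A (g ` D)" using that restrictions_mono[OF im] by (rule subsetD[rotated])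
        then show ?thesis using c True by (auto split: if_splits)
      qed
      then show ?thesis
        using m_closed_H[OF g(1) h(1)] order_trans[OF im g(2)]
        by (intro bexI[of _ "g \<otimes>\<^bsub>G\<^esub> h"] conjI exI[of _ r] ballI)
    next
      case False
      then have less: "\<kappa> f < r" if "f \<in> restrictions A (g ` D)" for f
      proof -
        have "\<kappa> f < Suc r" using \<kappa> that restrictions_mono[OF g(2)] by (auto simp: Pi_iff)
        moreover have "\<kappa> f \<noteq> r" using c that False by (auto split: if_splits)
        ultimately show ?thesis by simp
      qed
      \<comment> \<open>The colouring of the restrictions into the translate of \<open>D\<close> by
        \<open>g\<close> is read as an \<open>r\<close>-colouring of those into
        \<open>D\<close>.\<close>
      obtain h d where h: "h \<in> H" "h ` B \<subseteq> D"
        and d: "\<forall>f\<in>restrictions A (h ` B). \<kappa> (compose A g f) = d"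
        using bspec[OF D(3)[unfolded arrow_def], of "\<lambda>f. \<kappa> (compose A g f)"] comp less
        by auto
      have im: "(g \<otimes>\<^bsub>G\<^esub> h) ` B = g ` h ` B"
        using mult_image[OF g(1) h(1)] * by auto
      have "\<kappa> f = d" if "f \<in> restrictions A ((g \<otimes>\<^bsub>G\<^esub> h) ` B)" for f
      proof -
        have "A \<subseteq> \<Omega>" "h ` B \<subseteq> \<Omega>" using * h(2) D(2) by auto
        from compose_inv_restrictions[OF g(1) that[unfolded im] this] d show ?thesis
          by (metis (no_types))
      qed
      moreover have "(g \<otimes>\<^bsub>G\<^esub> h) ` B \<subseteq> C"
        unfolding im using image_mono[OF h(2)] g(2) by (rule order_trans)
      ultimately show ?thesis
        using m_closed_H[OF g(1) h(1)]
        by (intro bexI[of _ "g \<otimes>\<^bsub>G\<^esub> h"] conjI exI[of _ d] ballI)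
    qed
  qed
  then show "\<exists>C. finite C \<and> C \<subseteq> \<Omega> \<and> arrow (Suc r) A B C"
    using C by blast
qed

lemma ramsey_all:
  assumes "ramsey 2" "r > 0"
  shows "ramsey r"
  using assms(2)
proof (induction r rule: nat_induct_non_zero)
  case 1
  then show ?case by (rule ramsey_one)
next
  case (Suc n)
  then show ?case using ramsey_Suc[OF assms(1)] by blast
qed

section \<open>Basic open sets of the pointwise topology\<close>

lemma openin_T_agree:
  assumes "finite A" "A \<subseteq> \<Omega>" "g \<in> H"
  shows "openin T {h \<in> H. \<forall>a\<in>A. h a = g a}"
\<comment> \<open>An intersection over the empty set would be \<open>UNIV\<close> instead of
  \<open>H\<close>.\<close>
proof (cases "A = {}")
  case True
  then show ?thesis using openin_topspace[of T] by (simp add: topspace_T)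
next
  case False
  have "openin T {h \<in> H. h a = g a}" if "a \<in> A" for a
  proof -
    have "continuous_map T (discrete_topology \<Omega>) (\<lambda>h. h a)"
      unfolding T_def using that assms(2)
      by (intro continuous_map_from_subtopology continuous_map_product_projection) auto
    moreover have "openin (discrete_topology \<Omega>) {g a}"
      using that assms app_closed by auto
    ultimately have "openin T {h \<in> topspace T. h a \<in> {g a}}"
      by (rule openin_continuous_map_preimage)
    then show ?thesis by (simp add: topspace_T)
  qed
  then have "openin T (\<Inter>a\<in>A. {h \<in> H. h a = g a})"
    using assms(1) False by (intro openin_INT2) auto
  moreover have "(\<Inter>a\<in>A. {h \<in> H. h a = g a}) = {h \<in> H. \<forall>a\<in>A. h a = g a}"
    using False by auto
  ultimately show ?thesis by simp
qed

text \<open>The pointwise stabilisers of finite sets form a neighbourhood base at the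
  identity.\<close>

lemma openin_T_one:
  assumes "openin T U" "\<one>\<^bsub>G\<^esub> \<in> U"
  obtains A where "finite A" "A \<subseteq> \<Omega>" "\<And>h. h \<in> H \<Longrightarrow> (\<And>a. a \<in> A \<Longrightarrow> h a = a) \<Longrightarrow> h \<in> U"
proof -
  obtain U' where U': "openin (product_topology (\<lambda>_. discrete_topology \<Omega>) \<Omega>) U'" "U = U' \<inter> H"
    using assms(1) by (auto simp: T_def openin_subtopology)
  then obtain V where V: "finite {i \<in> \<Omega>. V i \<noteq> \<Omega>}" "\<one>\<^bsub>G\<^esub> \<in> Pi\<^sub>E \<Omega> V" "Pi\<^sub>E \<Omega> V \<subseteq> U'"
    using assms(2) unfolding openin_product_topology_alt by force
  \<comment> \<open>The finite set consists of the coordinates on which the basic box is a genuine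
    restriction.\<close>
  show ?thesis
  proof (rule that[OF V(1)])
    fix h assume h: "h \<in> H" "\<And>a. a \<in> {i \<in> \<Omega>. V i \<noteq> \<Omega>} \<Longrightarrow> h a = a"
    have "h i \<in> V i" if "i \<in> \<Omega>" for i
    proof (cases "V i = \<Omega>")
      case True
      then show ?thesis using h(1) that app_closed by simp
    next
      case False
      then have "h i = \<one>\<^bsub>G\<^esub> i" using h(2) that one_app by auto
      then show ?thesis using V(2) that by auto
    qed
    then have "h \<in> Pi\<^sub>E \<Omega> V" using H_Bij[OF h(1)] by (auto simp: PiE_def Bij_def)
    then show "h \<in> U" using V(3) U'(2) h(1) by auto
  qed auto
qed

section \<open>From the Ramsey property to fixed points\<close>

text \<open>Separating \<open>x\<close> from its image under \<open>g\<close> yields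
  \<open>U\<close>, and joint continuity at the identity and \<open>x\<close> yields
  \<open>W\<close> and \<open>A\<close>. The margin between \<open>W\<close> and \<open>U\<close>
  later absorbs the choice of a representative in a coset of the stabiliser.\<close>

lemma displacing_neighbourhood:
  assumes X: "Hausdorff_space X" and act: "continuous_action G T X \<phi>"
    and x: "x \<in> topspace X" and g: "g \<in> H" "\<phi> g x \<noteq> x"
  obtains U W A where "\<And>y. y \<in> U \<Longrightarrow> \<phi> g y \<notin> U" "openin X W" "x \<in> W" "finite A" "A \<subseteq> \<Omega>"
    "\<And>h y. h \<in> H \<Longrightarrow> (\<And>a. a \<in> A \<Longrightarrow> h a = a) \<Longrightarrow> y \<in> W \<Longrightarrow> \<phi> h y \<in> U"
proof -
  interpret group_action G "topspace X" \<phi> using act by (simp add: continuous_action_def)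
  have cont: "continuous_map (prod_topology T X) X (\<lambda>(g, x). \<phi> g x)"
    using act by (simp add: continuous_action_def)
  have "continuous_map X (prod_topology T X) (\<lambda>y. (g, y))"
    using g(1) by (simp add: continuous_map_paired topspace_T)
  from continuous_map_compose[OF this cont]
  have cont_g: "continuous_map X X (\<phi> g)" by (simp add: comp_def)
  have "\<phi> g x \<in> topspace X" using element_image g x by auto
  then obtain P Q where PQ: "openin X P" "openin X Q" "x \<in> P" "\<phi> g x \<in> Q" "disjnt P Q"
    using X x g(2) unfolding Hausdorff_space_def by metis
  define U where "U = {y \<in> P. \<phi> g y \<in> Q}"
  have U: "openin X U"
    unfolding U_def by (rule openin_continuous_map_preimage_gen[OF cont_g PQ(1,2)])
  have disj: "\<phi> g y \<notin> U" if "y \<in> U" for y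
    using that PQ(5) by (auto simp: U_def disjnt_def)
  have open_pre: "openin (prod_topology T X) {p \<in> topspace (prod_topology T X). (\<lambda>(g, x). \<phi> g x) p \<in> U}"
    by (rule openin_continuous_map_preimage[OF cont U])
  have "\<phi> \<one>\<^bsub>G\<^esub> x = x" using id_eq_one x by (metis restrict_apply')
  then have "(\<one>\<^bsub>G\<^esub>, x) \<in> {p \<in> topspace (prod_topology T X). (\<lambda>(g, x). \<phi> g x) p \<in> U}"
    using x PQ one_H by (simp add: topspace_T U_def)
  then obtain V W where VW: "openin T V" "openin X W" "\<one>\<^bsub>G\<^esub> \<in> V" "x \<in> W"
    "V \<times> W \<subseteq> {p \<in> topspace (prod_topology T X). (\<lambda>(g, x). \<phi> g x) p \<in> U}"
    using open_pre unfolding openin_prod_topology_alt by meson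
  obtain A where A: "finite A" "A \<subseteq> \<Omega>"
    "\<And>h. h \<in> H \<Longrightarrow> (\<And>a. a \<in> A \<Longrightarrow> h a = a) \<Longrightarrow> h \<in> V"
    using openin_T_one[OF VW(1,3)] by blast
  have "\<phi> h y \<in> U" if "h \<in> H" "\<And>a. a \<in> A \<Longrightarrow> h a = a" "y \<in> W" for h y
    using VW(5) A(3)[OF that(1,2)] that(3) by auto
  with disj VW A show ?thesis by (intro that[of U W A]) auto
qed

theorem ramsey_imp_extremely_amenable:
  assumes "ramsey 2"
  shows "extremely_amenable TYPE('x) G T"
  unfolding extremely_amenable_def
proof (intro allI impI, rule ccontr)
  fix X :: "'x topology" and \<phi>
  assume *: "topspace X \<noteq> {} \<and> compact_space X \<and> Hausdorff_space X \<and> continuous_action G T X \<phi>"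
    and no_fix: "\<not> (\<exists>x\<in>topspace X. \<forall>g\<in>carrier G. \<phi> g x = x)"
  interpret act: group_action G "topspace X" \<phi> using * by (simp add: continuous_action_def)
  have "\<forall>x\<in>topspace X. \<exists>g U W A. g \<in> H \<and> (\<forall>y\<in>U. \<phi> g y \<notin> U) \<and> openin X W \<and> x \<in> W \<and>
      finite A \<and> A \<subseteq> \<Omega> \<and> (\<forall>h\<in>H. (\<forall>a\<in>A. h a = a) \<longrightarrow> (\<forall>y\<in>W. \<phi> h y \<in> U))"
  proof
    fix x assume x: "x \<in> topspace X"
    then obtain g where g: "g \<in> H" "\<phi> g x \<noteq> x" using no_fix by auto
    obtain U W A where "\<And>y. y \<in> U \<Longrightarrow> \<phi> g y \<notin> U" "openin X W" "x \<in> W" "finite A" "A \<subseteq> \<Omega>"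
      "\<And>h y. h \<in> H \<Longrightarrow> (\<And>a. a \<in> A \<Longrightarrow> h a = a) \<Longrightarrow> y \<in> W \<Longrightarrow> \<phi> h y \<in> U"
      using displacing_neighbourhood[where X = X and \<phi> = \<phi>, OF _ _ x g] * by metis
    then show "\<exists>g U W A. g \<in> H \<and> (\<forall>y\<in>U. \<phi> g y \<notin> U) \<and> openin X W \<and> x \<in> W \<and>
      finite A \<and> A \<subseteq> \<Omega> \<and> (\<forall>h\<in>H. (\<forall>a\<in>A. h a = a) \<longrightarrow> (\<forall>y\<in>W. \<phi> h y \<in> U))"
      using g(1) by (intro exI[of _ g] exI[of _ U] exI[of _ W] exI[of _ A]) blast
  qed
  then obtain g U W A where cover: "\<And>x. x \<in> topspace X \<Longrightarrow> g x \<in> H \<and> (\<forall>y\<in>U x. \<phi> (g x) y \<notin> U x) \<and>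
      openin X (W x) \<and> x \<in> W x \<and> finite (A x) \<and> A x \<subseteq> \<Omega> \<and>
      (\<forall>h\<in>H. (\<forall>a\<in>A x. h a = a) \<longrightarrow> (\<forall>y\<in>W x. \<phi> h y \<in> U x))"
    by metis
  have "(\<forall>V \<in> W ` topspace X. openin X V) \<and> topspace X \<subseteq> \<Union> (W ` topspace X)"
    using cover by auto
  then have "\<exists>\<F>. finite \<F> \<and> \<F> \<subseteq> W ` topspace X \<and> topspace X \<subseteq> \<Union>\<F>"
    using * unfolding compact_space_alt by meson
  then obtain F where F: "finite F" "F \<subseteq> topspace X" "topspace X \<subseteq> (\<Union>x\<in>F. W x)"
    by (metis finite_subset_image)
  obtain x0 where x0: "x0 \<in> topspace X" using * by blast
  \<comment> \<open>The colours of \<open>arrow\<close> are natural numbers, so the members of the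
    finite cover are numbered.\<close>
  obtain idx :: "_ \<Rightarrow> nat" where idx: "bij_betw idx F {0..<card F}"
    using ex_bij_betw_finite_nat[OF F(1)] by blast
  \<comment> \<open>One finite set whose stabiliser is small enough for all members of the cover
    simultaneously.\<close>
  define D where "D = (\<Union>x\<in>F. A x)"
  \<comment> \<open>This ensures that, for every \<open>h\<close> in \<open>H\<close> and
    \<open>x\<close> in \<open>F\<close>, both \<open>h\<close> and \<open>h\<close> times the
    inverse of \<open>g x\<close> map \<open>D\<close> into the image of \<open>B\<close> under
    \<open>h\<close>.\<close>
  define B where "B = D \<union> (\<Union>x\<in>F. (inv\<^bsub>G\<^esub> (g x)) ` D)"
  have gH: "g x \<in> H" "finite (A x)" "A x \<subseteq> \<Omega>" if "x \<in> F" for x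
    using cover[of x] that F(2) by auto
  have D: "finite D" "D \<subseteq> \<Omega>" unfolding D_def using F(1) gH by auto
  have "(inv\<^bsub>G\<^esub> (g x)) ` D \<subseteq> \<Omega>" if "x \<in> F" for x
    using app_closed[OF inv_closed_H[OF gH(1)[OF that]]] D(2) by auto
  then have B: "finite B" "B \<subseteq> \<Omega>"
    unfolding B_def using F(1) D by auto
  have "F \<noteq> {}" using F(3) x0 by auto
  then have "ramsey (card F)" using ramsey_all[OF assms] F(1) by (simp add: card_gt_0_iff)
  then obtain C where C: "arrow (card F) D B C"
    by (rule ramseyE[OF _ D B])
  define c where "c h = (SOME x. x \<in> F \<and> \<phi> (inv\<^bsub>G\<^esub> h) x0 \<in> W x)" for h
  define rep where "rep f = (SOME h. h \<in> H \<and> (\<forall>a\<in>D. f a = h a))" for f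
  have c: "c h \<in> F \<and> \<phi> (inv\<^bsub>G\<^esub> h) x0 \<in> W (c h)" if "h \<in> H" for h
  proof -
    have "\<phi> (inv\<^bsub>G\<^esub> h) x0 \<in> topspace X"
      using act.element_image[OF _ x0] inv_closed_H[OF that] by auto
    then have "\<exists>x. x \<in> F \<and> \<phi> (inv\<^bsub>G\<^esub> h) x0 \<in> W x" using F(3) by auto
    then show ?thesis unfolding c_def by (rule someI_ex)
  qed
  have rep: "rep f \<in> H \<and> (\<forall>a\<in>D. f a = rep f a)" if "f \<in> restrictions D E" for f E
  proof -
    have "\<exists>h. h \<in> H \<and> (\<forall>a\<in>D. f a = h a)" using that by (auto simp: restrictions_def)
    then show ?thesis unfolding rep_def by (rule someI_ex)
  qed
  \<comment> \<open>The colour of a coset of the stabiliser of \<open>D\<close> is read off from one representative; for all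
    other members \<open>h\<close> of the coset, the point is still in the slightly larger set \<open>U\<close>.\<close>
  have colour: "\<phi> (inv\<^bsub>G\<^esub> h) x0 \<in> U (c (rep (restrict h D)))" if "h \<in> H" for h
  proof -
    let ?r = "rep (restrict h D)"
    have r: "?r \<in> H" "\<forall>a\<in>D. h a = ?r a"
      using rep[OF restrict_restrictions[OF that subset_refl]] by auto
    \<comment> \<open>As \<open>h\<close> and \<open>?r\<close> agree on \<open>D\<close>, this
      product fixes \<open>D\<close> pointwise. It moves the translate of \<open>x0\<close> by the
      inverse of \<open>?r\<close>, which is in \<open>W\<close>, to the translate by the inverse of
      \<open>h\<close>, which is therefore in \<open>U\<close>.\<close>
    have k: "((inv\<^bsub>G\<^esub> h) \<otimes>\<^bsub>G\<^esub> ?r) a = a" if "a \<in> D" for a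
    proof -
      have "((inv\<^bsub>G\<^esub> h) \<otimes>\<^bsub>G\<^esub> ?r) a = (inv\<^bsub>G\<^esub> h) (h a)"
        using mult_app[OF inv_closed_H[OF \<open>h \<in> H\<close>] r(1)] r(2) that D(2) by auto
      then show ?thesis using inv_app[OF \<open>h \<in> H\<close>] that D(2) by auto
    qed
    have kH: "(inv\<^bsub>G\<^esub> h) \<otimes>\<^bsub>G\<^esub> ?r \<in> H" using r(1) that inv_closed_H m_closed_H by auto
    have "A (c ?r) \<subseteq> D" using c[OF r(1)] by (auto simp: D_def)
    then have "\<phi> ((inv\<^bsub>G\<^esub> h) \<otimes>\<^bsub>G\<^esub> ?r) (\<phi> (inv\<^bsub>G\<^esub> ?r) x0) \<in> U (c ?r)"
      using cover[of "c ?r"] c[OF r(1)] F(2) k kH by blast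
    moreover have "\<phi> ((inv\<^bsub>G\<^esub> h) \<otimes>\<^bsub>G\<^esub> ?r) (\<phi> (inv\<^bsub>G\<^esub> ?r) x0) = \<phi> (inv\<^bsub>G\<^esub> h) x0"
    proof -
      have "(inv\<^bsub>G\<^esub> h) \<otimes>\<^bsub>G\<^esub> ?r \<otimes>\<^bsub>G\<^esub> (inv\<^bsub>G\<^esub> ?r) = (inv\<^bsub>G\<^esub> h)"
        using r(1) that inv_closed_H by (simp add: m_assoc)
      then show ?thesis
        using act.composition_rule[OF x0, of "(inv\<^bsub>G\<^esub> h) \<otimes>\<^bsub>G\<^esub> ?r" "inv\<^bsub>G\<^esub> ?r"] kH inv_closed_H[OF r(1)]
        by simp
    qed
    ultimately show ?thesis by simp
  qed
  have "(\<lambda>f. idx (c (rep f))) \<in> restrictions D C \<rightarrow> {..<card F}"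
    using rep c idx by (auto simp: bij_betw_def)
  then obtain h k where h: "h \<in> H"
    and mono: "\<forall>f\<in>restrictions D (h ` B). idx (c (rep f)) = k"
    using bspec[OF C[unfolded arrow_def]] by (metis (no_types, lifting))
  let ?f = "restrict h D"
  have f: "?f \<in> restrictions D (h ` B)"
    using h by (intro restrict_restrictions) (auto simp: B_def)
  define j where "j = c (rep ?f)"
  have j: "j \<in> F" "g j \<in> H" "j \<in> topspace X"
    using c rep[OF f] F(2) cover by (auto simp: j_def)
  \<comment> \<open>The inverse of \<open>?h'\<close> is \<open>g j\<close> times the inverse of
    \<open>h\<close>. Since \<open>h\<close> and \<open>?h'\<close> get the same colour
    \<open>j\<close>, a point of \<open>U j\<close> and its image under \<open>g j\<close> will both
    be in \<open>U j\<close>, against the choice of \<open>U j\<close>.\<close>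
  let ?h' = "h \<otimes>\<^bsub>G\<^esub> (inv\<^bsub>G\<^esub> (g j))"
  have h': "?h' \<in> H" using h j inv_closed_H m_closed_H by auto
  have "?h' ` D = h ` (inv\<^bsub>G\<^esub> (g j)) ` D"
    using mult_image[OF h inv_closed_H[OF j(2)] D(2)] .
  then have f': "restrict ?h' D \<in> restrictions D (h ` B)"
    using h' j(1) by (intro restrict_restrictions) (auto simp: B_def)
  have "idx (c (rep (restrict ?h' D))) = idx j" using mono f f' by (simp add: j_def)
  moreover have "c (rep (restrict ?h' D)) \<in> F" using c rep[OF f'] by blast
  ultimately have "c (rep (restrict ?h' D)) = j"
    using idx j(1) by (meson bij_betw_imp_inj_on inj_onD)
  then have "\<phi> (inv\<^bsub>G\<^esub> ?h') x0 \<in> U j" using colour[OF h'] by simp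
  moreover have "\<phi> (inv\<^bsub>G\<^esub> h) x0 \<in> U j" using colour[OF h] by (simp add: j_def)
  moreover have "\<phi> (inv\<^bsub>G\<^esub> ?h') x0 = \<phi> (g j) (\<phi> (inv\<^bsub>G\<^esub> h) x0)"
    using h j act.composition_rule[OF x0, of "g j" "inv\<^bsub>G\<^esub> h"] inv_closed_H
    by (simp add: inv_mult_group)
  ultimately show False using cover[OF j(3)] by auto
qed

section \<open>From fixed points to the Ramsey property: translation of colourings\<close>

lemma compose_restrictions_univ:
  assumes "g \<in> H" "f \<in> restrictions A \<Omega>" "A \<subseteq> \<Omega>"
  shows "compose A g f \<in> restrictions A \<Omega>"
proof -
  have "g ` \<Omega> \<subseteq> \<Omega>" using app_closed[OF assms(1)] by auto
  from subsetD[OF restrictions_mono[OF this] compose_restrictions[OF assms]] show ?thesis .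
qed

lemma compose_mult:
  assumes "g \<in> H" "h \<in> H" "f \<in> restrictions A \<Omega>"
  shows "compose A (g \<otimes>\<^bsub>G\<^esub> h) f = compose A g (compose A h f)"
  using assms by (auto simp: compose_def fun_eq_iff restrictions_def mult_app PiE_iff)

lemma compose_one:
  assumes "f \<in> restrictions A \<Omega>"
  shows "compose A \<one>\<^bsub>G\<^esub> f = f"
  using assms
  by (intro extensionalityI[of _ A]) (auto simp: compose_def restrictions_def one_app PiE_iff)

text \<open>With \<open>bool\<close> in place of the two colours, colourings are functions of
  exactly the type on which \<open>EA\<close> provides fixed points.\<close>

theorem extremely_amenable_imp_ramsey:
  assumes EA: "extremely_amenable TYPE(('a \<Rightarrow> 'a) \<Rightarrow> bool) G T"
  shows "ramsey 2"
  unfolding ramsey_def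
proof (intro allI impI, rule ccontr)
  fix A B :: "'a set"
  assume *: "finite A \<and> A \<subseteq> \<Omega> \<and> finite B \<and> B \<subseteq> \<Omega>"
    and bad: "\<not> (\<exists>C. finite C \<and> C \<subseteq> \<Omega> \<and> arrow 2 A B C)"
  have A: "finite A" "A \<subseteq> \<Omega>" and B: "finite B" "B \<subseteq> \<Omega>" using * by auto
  define K where "K = restrictions A \<Omega>"
  define P where "P = product_topology (\<lambda>_. discrete_topology (UNIV :: bool set)) K"
  \<comment> \<open>Membership tests only the values at the finitely many restrictions into the
    image of \<open>B\<close> under \<open>g\<close>; this is why \<open>D g\<close> is
    closed.\<close>
  define D where "D g = {\<kappa> \<in> topspace P. \<exists>f\<in>restrictions A (g ` B). \<exists>f'\<in>restrictions A (g ` B). \<kappa> f \<noteq> \<kappa> f'}" for g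
  define Y where "Y = (\<Inter>g\<in>H. D g)"
  have image_B: "finite (g ` B)" "g ` B \<subseteq> \<Omega>" if "g \<in> H" for g
    using B app_closed[OF that] by auto
  have sub_K: "restrictions A C \<subseteq> K" if "C \<subseteq> \<Omega>" for C
    unfolding K_def using restrictions_mono[OF that] .
  have proj: "continuous_map P (discrete_topology UNIV) (\<lambda>\<kappa>. \<kappa> f)" if "f \<in> K" for f
    unfolding P_def using that by (rule continuous_map_product_projection)
  have cont_P: "continuous_map Z P F \<longleftrightarrow> F ` topspace Z \<subseteq> extensional K \<and>
      (\<forall>f\<in>K. continuous_map Z (discrete_topology UNIV) (\<lambda>p. F p f))"
    for Z :: "'z topology" and F
    unfolding P_def by (rule continuous_map_componentwise)
  have closed_D: "closedin P (D g)" if "g \<in> H" for g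
  proof -
    let ?R = "restrictions A (g ` B)"
    have "closedin P {\<kappa> \<in> topspace P. \<kappa> f \<noteq> \<kappa> f'}" if "f \<in> K" "f' \<in> K" for f f'
    proof -
      have "closedin P ({\<kappa> \<in> topspace P. \<kappa> f \<in> {b}} \<inter> {\<kappa> \<in> topspace P. \<kappa> f' \<in> {\<not> b}})" for b
        using that by (intro closedin_Int closedin_continuous_map_preimage[OF proj]) auto
      then have "closedin P (({\<kappa> \<in> topspace P. \<kappa> f \<in> {True}} \<inter> {\<kappa> \<in> topspace P. \<kappa> f' \<in> {\<not> True}})
          \<union> ({\<kappa> \<in> topspace P. \<kappa> f \<in> {False}} \<inter> {\<kappa> \<in> topspace P. \<kappa> f' \<in> {\<not> False}}))"
        by (intro closedin_Un)
      moreover have "({\<kappa> \<in> topspace P. \<kappa> f \<in> {True}} \<inter> {\<kappa> \<in> topspace P. \<kappa> f' \<in> {\<not> True}})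
          \<union> ({\<kappa> \<in> topspace P. \<kappa> f \<in> {False}} \<inter> {\<kappa> \<in> topspace P. \<kappa> f' \<in> {\<not> False}})
          = {\<kappa> \<in> topspace P. \<kappa> f \<noteq> \<kappa> f'}" by auto
      ultimately show ?thesis by simp
    qed
    then have "closedin P (\<Union>(f, f') \<in> ?R \<times> ?R. {\<kappa> \<in> topspace P. \<kappa> f \<noteq> \<kappa> f'})"
      using finite_restrictions[OF A(1) image_B(1)[OF that]] sub_K[OF image_B(2)[OF that]]
      by (intro closedin_Union) auto
    moreover have "D g = (\<Union>(f, f') \<in> ?R \<times> ?R. {\<kappa> \<in> topspace P. \<kappa> f \<noteq> \<kappa> f'})"
      by (auto simp: D_def)
    ultimately show ?thesis by simp
  qed
  have top_P: "topspace P = K \<rightarrow>\<^sub>E UNIV" by (simp add: P_def)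
  have compact_P: "compact_space P"
    unfolding P_def compact_space_product_topology by (simp add: compact_space_discrete_topology)
  \<comment> \<open>Finitely many translates of \<open>B\<close> have a finite union
    \<open>C\<close>, and a colouring witnessing that the arrow fails for \<open>C\<close> is bad
    below each of them.\<close>
  have fip: "(\<Inter>g\<in>S. D g) \<noteq> {}" if S: "finite S" "S \<subseteq> H" for S
  proof -
    define C where "C = (\<Union>g\<in>S. g ` B)"
    have C: "finite C" unfolding C_def using S image_B(1) by auto
    have "C \<subseteq> \<Omega>" unfolding C_def using S(2) image_B(2) by (intro UN_least) auto
    then have "\<not> arrow 2 A B C" using bad C by blast
    then obtain \<kappa> where \<kappa>: "\<kappa> \<in> restrictions A C \<rightarrow> {..<(2::nat)}"
      and no_g: "\<not> (\<exists>g\<in>H. g ` B \<subseteq> C \<and> (\<exists>c. \<forall>f\<in>restrictions A (g ` B). \<kappa> f = c))"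
      unfolding arrow_def Ball_def[of "restrictions A C \<rightarrow> _"] not_all not_imp by (elim exE conjE)
    have \<kappa>_bad: "\<exists>f\<in>restrictions A (g ` B). \<kappa> f \<noteq> c" if "g \<in> H" "g ` B \<subseteq> C" for g c
      using no_g that by auto
    \<comment> \<open>The values of \<open>\<kappa>\<close> outside \<open>restrictions A C\<close>
      are arbitrary, but \<open>D g\<close> does not look at them when \<open>g\<close> is in
      \<open>S\<close>.\<close>
    have "restrict (\<lambda>f. \<kappa> f = 1) K \<in> D g" if "g \<in> S" for g
    proof -
      have g: "g \<in> H" "g ` B \<subseteq> C" using that S by (auto simp: C_def)
      obtain f where f: "f \<in> restrictions A (g ` B)" using \<kappa>_bad[OF g] by blast
      obtain f' where f': "f' \<in> restrictions A (g ` B)" "\<kappa> f' \<noteq> \<kappa> f" using \<kappa>_bad[OF g] by blast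
      have "\<kappa> f < 2" "\<kappa> f' < 2"
        using f f' \<kappa> restrictions_mono[OF g(2), of A] by (auto simp: Pi_iff)
      then have "(\<kappa> f = 1) \<noteq> (\<kappa> f' = 1)" using f'(2) by linarith
      moreover have "f \<in> K" "f' \<in> K" using f f' sub_K[OF image_B(2)[OF g(1)]] by auto
      ultimately show ?thesis
        using f f'(1) unfolding D_def top_P by auto
    qed
    then show ?thesis by blast
  qed
  have "Y \<noteq> {}"
  proof -
    have "\<Inter>\<F> \<noteq> {}" if "finite \<F>" "\<F> \<subseteq> D ` H" for \<F>
      using that fip by (metis finite_subset_image)
    then show ?thesis
      using compact_P closed_D unfolding compact_space_fip Y_def by simp
  qed
  have Y_P: "Y \<subseteq> topspace P" using one_H by (auto simp: Y_def D_def)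
  have "closedin P Y"
    unfolding Y_def using one_H closed_D by (intro closedin_INT) auto
  then have compact_Y: "compact_space (subtopology P Y)"
    by (intro compact_space_subtopology closedin_compact_space compact_P)
  have Hausdorff_Y: "Hausdorff_space (subtopology P Y)"
    by (intro Hausdorff_space_subtopology) (simp add: P_def Hausdorff_space_product_topology)
  have top_Y: "topspace (subtopology P Y) = Y" using Y_P by auto
  \<comment> \<open>Precomposition reverses the order of products; the inverse turns it into a left
    action.\<close>
  define \<psi> where "\<psi> g = (\<lambda>\<kappa>\<in>Y. \<lambda>f\<in>K. \<kappa> (compose A (inv\<^bsub>G\<^esub> g) f))" for g
  have shift_K: "compose A g f \<in> K" if "g \<in> H" "f \<in> K" for g f
    using compose_restrictions_univ[OF that(1) _ A(2)] that(2) by (simp add: K_def)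
  have \<psi>: "\<psi> g \<kappa> f = \<kappa> (compose A (inv\<^bsub>G\<^esub> g) f)" if "\<kappa> \<in> Y" "f \<in> K" for g \<kappa> f
    using that by (simp add: \<psi>_def)
  have \<psi>_ext: "\<psi> g \<kappa> \<in> extensional K" if "\<kappa> \<in> Y" for g \<kappa>
    using that by (simp add: \<psi>_def)
  have compose_inv: "compose A (inv\<^bsub>G\<^esub> g) (compose A g f) = f" if "g \<in> H" "f \<in> K" for g f
    using compose_mult[OF inv_closed_H[OF that(1)] that(1), of f A] that l_inv[of g] compose_one[of f A]
    by (simp add: K_def)
  have \<psi>_Y: "\<psi> g \<kappa> \<in> Y" if g: "g \<in> H" and \<kappa>: "\<kappa> \<in> Y" for g \<kappa>
    unfolding Y_def
  proof
    fix h assume h: "h \<in> H"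
    let ?h' = "(inv\<^bsub>G\<^esub> g) \<otimes>\<^bsub>G\<^esub> h"
    have h': "?h' \<in> H" using g h inv_closed_H m_closed_H by auto
    have "\<kappa> \<in> D ?h'" using \<kappa> h' by (auto simp: Y_def)
    then obtain f f' where f: "f \<in> restrictions A (?h' ` B)" "f' \<in> restrictions A (?h' ` B)" "\<kappa> f \<noteq> \<kappa> f'"
      by (auto simp: D_def)
    \<comment> \<open>Translation by \<open>g\<close> carries the restrictions tested by
      \<open>D ?h'\<close> to those tested by \<open>D h\<close>, so two restrictions with different
      colours stay such a pair.\<close>
    have "g \<otimes>\<^bsub>G\<^esub> ?h' = h" using g h inv_closed_H by (simp add: m_assoc[symmetric])
    then have im: "g ` ?h' ` B = h ` B" using mult_image[OF g h' B(2)] by simp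
    have fK: "f \<in> K" "f' \<in> K" using f sub_K[OF image_B(2)[OF h']] by auto
    have "compose A g f \<in> restrictions A (h ` B)" "compose A g f' \<in> restrictions A (h ` B)"
      using compose_restrictions[OF g f(1) A(2)] compose_restrictions[OF g f(2) A(2)] unfolding im by auto
    moreover have "\<psi> g \<kappa> (compose A g f) \<noteq> \<psi> g \<kappa> (compose A g f')"
      using \<psi>[OF \<kappa> shift_K[OF g]] compose_inv[OF g] fK f(3) by simp
    moreover have "\<psi> g \<kappa> \<in> topspace P" using \<psi>_ext[OF \<kappa>] by (auto simp: top_P PiE_def)
    ultimately show "\<psi> g \<kappa> \<in> D h" unfolding D_def by blast
  qed
  have "group_action G Y \<psi>"
  proof (rule group_actionI)
    show "group G" ..
    show "\<psi> g \<kappa> \<in> Y" if "g \<in> carrier G" "\<kappa> \<in> Y" for g \<kappa> using \<psi>_Y that by simp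
    show "\<psi> g \<in> extensional Y" for g by (simp add: \<psi>_def)
    show "\<psi> \<one>\<^bsub>G\<^esub> \<kappa> = \<kappa>" if "\<kappa> \<in> Y" for \<kappa>
    proof (rule extensionalityI[of _ K])
      show "\<kappa> \<in> extensional K" using that Y_P by (auto simp: top_P PiE_def)
      show "\<psi> \<one>\<^bsub>G\<^esub> \<kappa> f = \<kappa> f" if "f \<in> K" for f
        using \<psi>[OF \<open>\<kappa> \<in> Y\<close> that] compose_one[of f A] that by (simp add: K_def)
    qed (use \<psi>_ext that in auto)
    show "\<psi> (g \<otimes>\<^bsub>G\<^esub> h) \<kappa> = \<psi> g (\<psi> h \<kappa>)"
      if "g \<in> carrier G" "h \<in> carrier G" "\<kappa> \<in> Y" for g h \<kappa>
    proof (rule extensionalityI[of _ K])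
      have H: "g \<in> H" "h \<in> H" using that by auto
      show "\<psi> (g \<otimes>\<^bsub>G\<^esub> h) \<kappa> \<in> extensional K" "\<psi> g (\<psi> h \<kappa>) \<in> extensional K"
        using \<psi>_ext \<psi>_Y H that(3) by auto
      fix f assume f: "f \<in> K"
      have "\<psi> g (\<psi> h \<kappa>) f = \<kappa> (compose A (inv\<^bsub>G\<^esub> h) (compose A (inv\<^bsub>G\<^esub> g) f))"
        using \<psi>[OF \<psi>_Y[OF H(2) that(3)] f] \<psi>[OF that(3) shift_K[OF inv_closed_H[OF H(1)] f]] by simp
      also have "\<dots> = \<psi> (g \<otimes>\<^bsub>G\<^esub> h) \<kappa> f"
        using \<psi>[OF that(3) f] compose_mult[OF inv_closed_H[OF H(2)] inv_closed_H[OF H(1)], of f A] f H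
        by (simp add: inv_mult_group K_def)
      finally show "\<psi> (g \<otimes>\<^bsub>G\<^esub> h) \<kappa> f = \<psi> g (\<psi> h \<kappa>) f" by simp
    qed
  qed
  moreover have "continuous_map (prod_topology T (subtopology P Y)) (subtopology P Y) (\<lambda>(g, \<kappa>). \<psi> g \<kappa>)"
    unfolding continuous_map_in_subtopology
  proof
    show "(\<lambda>(g, \<kappa>). \<psi> g \<kappa>) \<in> topspace (prod_topology T (subtopology P Y)) \<rightarrow> Y"
      using \<psi>_Y by (auto simp: topspace_T)
    show "continuous_map (prod_topology T (subtopology P Y)) P (\<lambda>(g, \<kappa>). \<psi> g \<kappa>)"
      unfolding cont_P
    proof (intro conjI ballI)
      show "(\<lambda>(g, \<kappa>). \<psi> g \<kappa>) ` topspace (prod_topology T (subtopology P Y)) \<subseteq> extensional K"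
        using \<psi>_ext by auto
      fix f assume f: "f \<in> K"
      show "continuous_map (prod_topology T (subtopology P Y)) (discrete_topology UNIV)
          (\<lambda>p. (case p of (g, \<kappa>) \<Rightarrow> \<psi> g \<kappa>) f)"
        unfolding continuous_map_def
      proof (intro conjI allI impI)
        fix V :: "bool set"
        show "openin (prod_topology T (subtopology P Y))
            {p \<in> topspace (prod_topology T (subtopology P Y)). (case p of (g, \<kappa>) \<Rightarrow> \<psi> g \<kappa>) f \<in> V}"
          unfolding openin_prod_topology_alt
        proof (intro allI impI)
          fix g \<kappa> assume "(g, \<kappa>) \<in> {p \<in> topspace (prod_topology T (subtopology P Y)).
            (case p of (g, \<kappa>) \<Rightarrow> \<psi> g \<kappa>) f \<in> V}"
          then have g: "g \<in> H" and \<kappa>: "\<kappa> \<in> Y" and V: "\<psi> g \<kappa> f \<in> V"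
            by (auto simp: topspace_T)
          \<comment> \<open>The value of the translated colouring at \<open>f\<close> is that of
            \<open>\<kappa>\<close> at \<open>f0\<close>. It does not change as long as the group
            element agrees with \<open>g\<close> on the finite image of \<open>f0\<close> and the
            colouring agrees with \<open>\<kappa>\<close> at \<open>f0\<close>; both are open
            conditions.\<close>
          define f0 where "f0 = compose A (inv\<^bsub>G\<^esub> g) f"
          have f0: "f0 \<in> K" unfolding f0_def by (rule shift_K[OF inv_closed_H[OF g] f])
          have f0_val: "f0 a \<in> \<Omega>" "g (f0 a) = f a" if "a \<in> A" for a
          proof -
            have "f a \<in> \<Omega>" using f that by (auto simp: K_def restrictions_def)
            then show "g (f0 a) = f a" using that app_inv[OF g] by (simp add: f0_def compose_def)
            show "f0 a \<in> \<Omega>" using f0 that by (auto simp: K_def restrictions_def)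
          qed
          let ?O = "{h \<in> H. \<forall>x\<in>f0 ` A. h x = g x}"
          let ?W = "{\<kappa>' \<in> topspace (subtopology P Y). \<kappa>' f0 \<in> {\<kappa> f0}}"
          have "openin T ?O"
            using A(1) f0_val(1) g by (intro openin_T_agree) auto
          moreover have "openin (subtopology P Y) ?W"
            using proj[OF f0] by (intro openin_continuous_map_preimage[OF continuous_map_from_subtopology]) auto
          moreover have "\<psi> h \<kappa>' f \<in> V" if "h \<in> ?O" "\<kappa>' \<in> ?W" for h \<kappa>'
          proof -
            have h: "h \<in> H" "\<And>a. a \<in> A \<Longrightarrow> h (f0 a) = f a" using that(1) f0_val(2) by auto
            have "compose A (inv\<^bsub>G\<^esub> h) f = f0"
            proof (rule extensionalityI[of _ A])
              show "f0 \<in> extensional A" by (simp add: f0_def)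
              show "compose A (inv\<^bsub>G\<^esub> h) f a = f0 a" if "a \<in> A" for a
                using inv_app[OF h(1) f0_val(1)[OF that]] h(2)[OF that] that by (simp add: compose_def)
            qed simp
            then have "\<psi> h \<kappa>' f = \<kappa> f0" using \<psi>[of \<kappa>' f h] that(2) f by auto
            also have "\<dots> = \<psi> g \<kappa> f" using \<psi>[OF \<kappa> f] by (simp add: f0_def)
            finally show ?thesis using V by simp
          qed
          ultimately show "\<exists>U W. openin T U \<and> openin (subtopology P Y) W \<and> g \<in> U \<and> \<kappa> \<in> W \<and>
              U \<times> W \<subseteq> {p \<in> topspace (prod_topology T (subtopology P Y)).
                (case p of (g, \<kappa>) \<Rightarrow> \<psi> g \<kappa>) f \<in> V}"
            using g \<kappa> Y_P by (intro exI[of _ ?O] exI[of _ ?W]) (auto simp: topspace_T)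
        qed
      qed simp
    qed
  qed
  ultimately have "continuous_action G T (subtopology P Y) \<psi>"
    by (simp add: continuous_action_def top_Y del: topspace_subtopology)
  then have "\<exists>\<kappa>\<in>Y. \<forall>g\<in>carrier G. \<psi> g \<kappa> = \<kappa>"
    using EA compact_Y Hausdorff_Y \<open>Y \<noteq> {}\<close> top_Y unfolding extremely_amenable_def by metis
  then obtain \<kappa> where \<kappa>: "\<kappa> \<in> Y" "\<And>g. g \<in> H \<Longrightarrow> \<psi> g \<kappa> = \<kappa>" by auto
  \<comment> \<open>\<open>H\<close> acts transitively on \<open>K\<close>, each member being a
    translate of the restricted identity, so an invariant colouring is constant.\<close>
  have const: "\<kappa> f = \<kappa> (restrict \<one>\<^bsub>G\<^esub> A)" if f: "f \<in> K" for f
  proof -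
    obtain g where g: "g \<in> H" "\<forall>x\<in>A. f x = g x" using f by (auto simp: K_def restrictions_def)
    have "compose A (inv\<^bsub>G\<^esub> g) f = restrict \<one>\<^bsub>G\<^esub> A"
      using g A(2) inv_app[OF g(1)] one_app
      by (intro extensionalityI[of _ A]) (auto simp: compose_def)
    then show ?thesis using \<psi>[OF \<kappa>(1) that, of g] \<kappa>(2)[OF g(1)] by simp
  qed
  have "\<kappa> \<in> D \<one>\<^bsub>G\<^esub>" using \<kappa>(1) one_H by (auto simp: Y_def)
  then obtain f f' where "f \<in> restrictions A (\<one>\<^bsub>G\<^esub> ` B)" "f' \<in> restrictions A (\<one>\<^bsub>G\<^esub> ` B)" "\<kappa> f \<noteq> \<kappa> f'"
    by (auto simp: D_def)
  then show False using const sub_K[OF image_B(2)[OF one_H]] by (metis subsetD)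
qed

end

section \<open>The automorphism group of an ultrahomogeneous structure\<close>

lemma subgroup_Aut:
  assumes "is_structure L M"
  shows "subgroup (carrier (Aut L M)) (BijGroup (univ M))"
proof -
  interpret group "BijGroup (univ M)" by (rule group_BijGroup)
  have carrier: "carrier (Aut L M) = {g \<in> Bij (univ M). isomorphism L M M g}"
    by (simp add: Aut_def)
  show ?thesis
  proof (rule subgroupI)
    show "carrier (Aut L M) \<subseteq> carrier (BijGroup (univ M))"
      by (auto simp: carrier BijGroup_def)
    have "isomorphism L M M (\<lambda>x. x)"
      using assms by (auto simp: isomorphism_def embedding_def)
    then have "isomorphism L M M (\<lambda>x\<in>univ M. x)" by (rule isomorphism_cong) simp
    then show "carrier (Aut L M) \<noteq> {}" using id_Bij[of "univ M"] by (auto simp: carrier)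
    fix g assume g: "g \<in> carrier (Aut L M)"
    then have "isomorphism L M M g" by (simp add: carrier)
    then have "isomorphism L M M (\<lambda>x\<in>univ M. inv_into (univ M) g x)"
      by (rule isomorphism_cong[OF isomorphism_inv]) simp
    moreover have "inv\<^bsub>BijGroup (univ M)\<^esub> g = (\<lambda>x\<in>univ M. inv_into (univ M) g x)"
      using g by (simp add: carrier inv_BijGroup)
    ultimately show "inv\<^bsub>BijGroup (univ M)\<^esub> g \<in> carrier (Aut L M)"
      using g restrict_inv_into_Bij by (auto simp: carrier)
    fix h assume h: "h \<in> carrier (Aut L M)"
    have iso: "isomorphism L M M g" "isomorphism L M M h" and Bij: "g \<in> Bij (univ M)" "h \<in> Bij (univ M)"
      using g h by (auto simp: carrier)
    have "isomorphism L M M (g \<circ> h)"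
      using iso embedding_comp[of L M M h M g] unfolding isomorphism_def image_comp[symmetric] by simp
    then have "isomorphism L M M (compose (univ M) g h)"
      by (rule isomorphism_cong) (simp add: compose_def)
    then show "g \<otimes>\<^bsub>BijGroup (univ M)\<^esub> h \<in> carrier (Aut L M)"
      using Bij compose_Bij by (auto simp: carrier BijGroup_def)
  qed
qed

locale ultrahomogeneous_structure =
  fixes L :: "('f, 'r) language" and M :: "('f, 'r, 'm) struct"
  assumes structure_M: "is_structure L M" and ultrahomogeneous_M: "ultrahomogeneous L M"
begin

sublocale permutation_group "univ M" "carrier (Aut L M)"
  by (rule permutation_group.intro) (rule subgroup_Aut[OF structure_M])

lemma Aut_eq: "Aut L M = G"
  unfolding G_def by (simp add: Aut_def)

lemma pointwise_topology_eq: "pointwise_topology L M = T"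
  by (simp add: T_def pointwise_topology_def)

section \<open>Translation between structures and their automorphism groups\<close>

text \<open>This is where ultrahomogeneity enters: a copy of \<open>A\<close> induces an isomorphism
  of generated substructures, which extends to an automorphism. Conversely, automorphisms preserve
  quantifier-free types.\<close>

lemma copies_eq_restrictions:
  assumes A: "finite A" "A \<subseteq> univ M" and C: "C \<subseteq> univ M"
  shows "copies L M A M C = restrictions A C"
proof (rule equalityI; rule subsetI)
  fix f assume "f \<in> copies L M A M C"
  then obtain as where as: "set as = A" "qftp L M (map f as) = qftp L M as" and f: "f \<in> A \<rightarrow>\<^sub>E C"
    by (auto simp: copies_def)
  let ?gen = "\<lambda>as. M\<lparr>univ := generated L M (set as)\<rparr>"
  have bs: "set (map f as) \<subseteq> univ M" using as(1) f C by auto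
  obtain h where h: "isomorphism L (?gen as) (?gen (map f as)) h" "map h as = map f as"
    using qftp_eq_imp_isomorphism[OF structure_M structure_M _ bs _ as(2)] as(1) A(2) by auto
  have "substructure L (?gen xs) M \<and> finitely_generated L (?gen xs)" if "set xs \<subseteq> univ M" for xs
    using that generated_subset[OF structure_M that]
    by (intro conjI substructure_restrict structure_M is_structure_generated finitely_generated_generated) auto
  then obtain g where g: "g \<in> carrier (Aut L M)" "\<forall>x\<in>univ (?gen as). g x = h x"
    using ultrahomogeneous_M h(1) bs as(1) A(2) unfolding ultrahomogeneous_def by meson
  have "f x = g x" if "x \<in> A" for x
  proof -
    have "h x = f x" using h(2) as(1) that by auto
    moreover have "x \<in> univ (?gen as)" using that as(1) by (auto intro: generated.base)
    ultimately show ?thesis using g(2) by auto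
  qed
  then show "f \<in> restrictions A C" using f g(1) by (auto simp: restrictions_def)
next
  fix f assume "f \<in> restrictions A C"
  then obtain g where f: "f \<in> A \<rightarrow>\<^sub>E C" and g: "g \<in> carrier (Aut L M)" "\<forall>x\<in>A. f x = g x"
    by (auto simp: restrictions_def)
  obtain as where as: "distinct as" "set as = A" using finite_distinct_list[OF A(1)] by blast
  have "embedding L M M g" using g(1) by (auto simp: Aut_def isomorphism_def)
  then have "qftp L M (map g as) = qftp L M as" using as(2) A(2) by (intro qftp_embedding) auto
  also have "map g as = map f as" using g(2) as(2) by simp
  finally show "f \<in> copies L M A M C" using f as by (auto simp only: copies_def mem_Collect_eq)
qed

lemma ramsey_arrow_iff_arrow:
  assumes A: "finite A" "A \<subseteq> univ M" and B: "finite B" "B \<subseteq> univ M" and C: "C \<subseteq> univ M"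
  shows "ramsey_arrow L M A B M C \<longleftrightarrow> arrow 2 A B C"
proof -
  have two: "{0, 1 :: nat} = {..<2}" by auto
  \<comment> \<open>It matches the two ways of singling out the copies below a copy of
    \<open>B\<close>: a smaller codomain in \<open>arrow\<close>, a condition on the image in
    \<open>ramsey_arrow\<close>.\<close>
  have restrict_eq: "restrictions A (g ` B) = {f \<in> restrictions A C. f ` A \<subseteq> g ` B}"
    if "g ` B \<subseteq> C" for g
    using that by (auto simp: restrictions_def PiE_iff)
  have "(\<exists>e\<in>restrictions B C. \<exists>c. \<forall>f\<in>restrictions A C. f ` A \<subseteq> e ` B \<longrightarrow> \<kappa> f = c) \<longleftrightarrow>
      (\<exists>g\<in>carrier (Aut L M). g ` B \<subseteq> C \<and> (\<exists>c. \<forall>f\<in>restrictions A (g ` B). \<kappa> f = c))" for \<kappa> :: "_ \<Rightarrow> nat"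
  proof
    assume "\<exists>e\<in>restrictions B C. \<exists>c. \<forall>f\<in>restrictions A C. f ` A \<subseteq> e ` B \<longrightarrow> \<kappa> f = c"
    then obtain e c where e: "e \<in> restrictions B C"
      and c: "\<forall>f\<in>restrictions A C. f ` A \<subseteq> e ` B \<longrightarrow> \<kappa> f = c" by blast
    obtain g where g: "g \<in> carrier (Aut L M)" "\<forall>x\<in>B. e x = g x" and eC: "e \<in> B \<rightarrow>\<^sub>E C"
      using e by (auto simp: restrictions_def)
    have im: "e ` B = g ` B" using g(2) by auto
    moreover have "e ` B \<subseteq> C" using eC by auto
    ultimately show "\<exists>g\<in>carrier (Aut L M). g ` B \<subseteq> C \<and> (\<exists>c. \<forall>f\<in>restrictions A (g ` B). \<kappa> f = c)"
      using c g(1) restrict_eq[of g] by (intro bexI[of _ g] conjI exI[of _ c]) auto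
  next
    assume "\<exists>g\<in>carrier (Aut L M). g ` B \<subseteq> C \<and> (\<exists>c. \<forall>f\<in>restrictions A (g ` B). \<kappa> f = c)"
    then obtain g c where g: "g \<in> carrier (Aut L M)" "g ` B \<subseteq> C"
      and c: "\<forall>f\<in>restrictions A (g ` B). \<kappa> f = c" by blast
    then show "\<exists>e\<in>restrictions B C. \<exists>c. \<forall>f\<in>restrictions A C. f ` A \<subseteq> e ` B \<longrightarrow> \<kappa> f = c"
      using restrict_restrictions[OF g] restrict_eq[OF g(2)]
      by (intro bexI[of _ "restrict g B"] exI[of _ c]) auto
  qed
  then show ?thesis
    unfolding ramsey_arrow_def arrow_def copies_eq_restrictions[OF A C] copies_eq_restrictions[OF B C] two
    by simp
qed

text \<open>Finite subsets of \<open>M\<close> are placed in the member of the age that they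
  generate, and finite subsets of a member are embedded in \<open>M\<close>; the arrow is
  transferred along these maps.\<close>

lemma f_ERP_Age_iff_ramsey: "f_ERP L (Age L M) \<longleftrightarrow> ramsey 2"
proof
  assume erp: "f_ERP L (Age L M)"
  show "ramsey 2"
    unfolding ramsey_def
  proof (intro allI impI)
    fix A B assume *: "finite A \<and> A \<subseteq> univ M \<and> finite B \<and> B \<subseteq> univ M"
    define S where "S = M\<lparr>univ := generated L M (A \<union> B)\<rparr>"
    have S: "S \<in> Age L M" unfolding S_def using * by (intro generated_in_Age structure_M) auto
    have AB: "A \<union> B \<subseteq> univ S" by (auto simp: S_def intro: generated.base)
    have "generated L M (A \<union> B) \<subseteq> univ M" using * by (intro generated_subset structure_M) auto
    then have emb_S: "embedding L S M (\<lambda>x. x)"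
      unfolding S_def by (intro embedding_restrict structure_M is_structure_generated)
    obtain N C where N: "N \<in> Age L M" and C: "finite C" "C \<subseteq> univ N" "ramsey_arrow L S A B N C"
      using erp S AB * unfolding f_ERP_def by (metis le_sup_iff)
    obtain j where j: "embedding L N M j" using N Age_iff[OF structure_M] by blast
    have jN: "inj_on j (univ N)" "j ` univ N \<subseteq> univ M" using j by (auto simp: embedding_def)
    have "ramsey_arrow L M ((\<lambda>x. x) ` A) ((\<lambda>x. x) ` B) M (j ` C)"
    proof (rule ramsey_arrow_transfer[OF _ _ _ _ C(3)])
      show "inj_on j C" using jN(1) C(2) by (rule inj_on_subset)
      show "qftp L M (map (\<lambda>x. x) as) = qftp L S as" if "set as \<subseteq> A \<union> B" for as
        using that AB by (intro qftp_embedding[OF emb_S]) auto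
      show "qftp L M (map j cs) = qftp L N cs" if "set cs \<subseteq> C" for cs
        using that C(2) by (intro qftp_embedding[OF j]) auto
    qed simp
    moreover have "j ` C \<subseteq> univ M" using jN(2) C(2) by auto
    ultimately have "arrow 2 A B (j ` C)" using ramsey_arrow_iff_arrow * by simp
    then show "\<exists>C. finite C \<and> C \<subseteq> univ M \<and> arrow 2 A B C"
      using C(1) \<open>j ` C \<subseteq> univ M\<close> by blast
  qed
next
  assume R: "ramsey 2"
  show "f_ERP L (Age L M)"
    unfolding f_ERP_def
  proof (intro ballI allI impI)
    fix S A B assume S: "S \<in> Age L M" and *: "finite A \<and> A \<subseteq> univ S \<and> finite B \<and> B \<subseteq> univ S"
    obtain j where j: "embedding L S M j" using S Age_iff[OF structure_M] by blast
    have jS: "inj_on j (univ S)" "j ` univ S \<subseteq> univ M" using j by (auto simp: embedding_def)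
    have fin: "finite (j ` A)" "finite (j ` B)" and sub: "j ` A \<subseteq> univ M" "j ` B \<subseteq> univ M"
      using * jS(2) by auto
    obtain C where C: "finite C" "C \<subseteq> univ M" "arrow 2 (j ` A) (j ` B) C"
      by (rule ramseyE[OF R fin(1) sub(1) fin(2) sub(2)])
    then have arrow: "ramsey_arrow L M (j ` A) (j ` B) M C"
      using ramsey_arrow_iff_arrow[OF fin(1) sub(1) fin(2) sub(2)] by simp
    define N where "N = M\<lparr>univ := generated L M C\<rparr>"
    have N: "N \<in> Age L M" unfolding N_def using C by (intro generated_in_Age structure_M)
    have CN: "C \<subseteq> univ N" by (auto simp: N_def intro: generated.base)
    have emb_N: "embedding L N M (\<lambda>x. x)"
      unfolding N_def
      by (intro embedding_restrict structure_M is_structure_generated generated_subset C(2))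
    let ?i = "inv_into (univ S) j"
    have ij: "?i (j x) = x" if "x \<in> univ S" for x using jS(1) that by simp
    have AB_S: "A \<union> B \<subseteq> univ S" using * by auto
    \<comment> \<open>On the side of \<open>A\<close> and \<open>B\<close> the transfer leads from
      \<open>M\<close> back to \<open>S\<close> along the inverse of \<open>j\<close>; on the side
      of \<open>C\<close> it leads from \<open>M\<close> to the substructure generated by
      \<open>C\<close>.\<close>
    have "ramsey_arrow L S (?i ` j ` A) (?i ` j ` B) N ((\<lambda>x. x) ` C)"
    proof (rule ramsey_arrow_transfer[OF _ _ _ _ arrow])
      show "inj_on ?i (j ` A \<union> j ` B)"
        by (rule inj_on_inv_into) (use AB_S in auto)
      show "qftp L S (map ?i as) = qftp L M as" if "set as \<subseteq> j ` A \<union> j ` B" for as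
      proof -
        have "j (?i y) = y \<and> ?i y \<in> univ S" if y: "y \<in> set as" for y
        proof -
          obtain x where "x \<in> univ S" "y = j x" using y \<open>set as \<subseteq> j ` A \<union> j ` B\<close> AB_S by blast
          then show ?thesis using ij by simp
        qed
        then have "map j (map ?i as) = as" "set (map ?i as) \<subseteq> univ S" by (auto intro!: map_idI)
        then show ?thesis using qftp_embedding[OF j, of "map ?i as"] by metis
      qed
      show "qftp L N (map (\<lambda>x. x) cs) = qftp L M cs" if "set cs \<subseteq> C" for cs
        using qftp_embedding[OF emb_N, of cs] that CN by simp
    qed simp
    moreover have "?i ` j ` A = A" "?i ` j ` B = B" using AB_S ij by (force simp: image_image)+
    ultimately show "\<exists>N\<in>Age L M. \<exists>C. finite C \<and> C \<subseteq> univ N \<and> ramsey_arrow L S A B N C"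
      using N C(1) CN by auto
  qed
qed

lemma finitary_Ramsey_class_Age_iff: "finitary_Ramsey_class L (Age L M) \<longleftrightarrow> ramsey 2"
  using f_ERP_Age_iff_ramsey HP_Age[OF structure_M] JEP_Age[OF structure_M]
  by (simp add: finitary_Ramsey_class_def)

end

text \<open>Fixed points for spaces on one suitable type suffice for the Ramsey property, which in
  turn gives fixed points on every type; the second conjunct records the latter.\<close>

theorem theorem3:
  fixes L :: "('f, 'r) language" and M :: "('f, 'r, 'm) struct"
  assumes "is_structure L M" and "ultrahomogeneous L M"
  shows "(extremely_amenable TYPE(('m \<Rightarrow> 'm) set set) (Aut L M) (pointwise_topology L M)
            \<longleftrightarrow> finitary_Ramsey_class L (Age L M))
       \<and> (finitary_Ramsey_class L (Age L M)
            \<longrightarrow> extremely_amenable TYPE('x) (Aut L M) (pointwise_topology L M))"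
proof -
  interpret ultrahomogeneous_structure L M using assms by unfold_locales
  \<comment> \<open>Turns a colouring into the singleton of its truth set, an injection into the
    type of sets of sets.\<close>
  let ?j = "\<lambda>\<kappa> :: ('m \<Rightarrow> 'm) \<Rightarrow> bool. {Collect \<kappa>}"
  have "inj ?j" by (auto simp: inj_def)
  then have "ramsey 2" if "extremely_amenable TYPE(('m \<Rightarrow> 'm) set set) G T"
    using extremely_amenable_transfer[of ?j G T] extremely_amenable_imp_ramsey that by simp
  moreover have "extremely_amenable TYPE(('m \<Rightarrow> 'm) set set) G T" if "ramsey 2"
    using that by (rule ramsey_imp_extremely_amenable)
  moreover have "extremely_amenable TYPE('x) G T" if "ramsey 2"
    using that by (rule ramsey_imp_extremely_amenable)
  ultimately show ?thesis
    unfolding finitary_Ramsey_class_Age_iff Aut_eq[symmetric] pointwise_topology_eq[symmetric]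
    by blast
qed

end
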